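(* Let $n\ge 2$ and let $(M,\mathcal D,g)$ be an $(n+1)$-dimensional simply connected sub-Riemannian manifold whose distribution $\mathcal D$, in a given local coordinate system $(x_i)_{i=1,\dots,n+1}$, is given by (is spanned by) the vector fields $$X_i=\partial_{x_i}+A_i\,\partial_{x_{n+1}},\qquad i=1,\dots,n,$$ where $A_i:M\to\mathbb R$ are smooth functions depending only on the first $n$ variables, $A_i=A_i(x_1,\dots,x_n)$. Assume that there are real constants $c_{ij}$ with $$\partial_{x_i}A_j-\partial_{x_j}A_i=c_{ij}\in\mathbb R\quad\text{for every } i,j=1,\dots,n,$$ and that $I_0=\{(i,j): c_{ij}\neq 0\}\neq\emptyset$. Let $\boldsymbol a\in\Gamma(\mathcal D)$ be a horizontal vector field, write $\boldsymbol a=\sum_{i=1}^n a_iX_i$, let $g_{ij}=g(X_i,X_j)$ $(i,j=1,\dots,n)$ and $\tilde a_j=\sum_{i=1}^n g_{ij}a_i$. Then the system $$\nabla_H u=\boldsymbol a\quad\text{in } M$$ has a solution $u\in\mathcal F(M)$ if and only if both of the following hold in $M$: $$c_{kl}\,(X_i\tilde a_j-X_j\tilde a_i)=c_{ij}\,(X_k\tilde a_l-X_l\tilde a_k)\quad\text{for every } i,j,k,l=1,\dots,n;$$ $$X_kX_i\tilde a_j-X_kX_j\tilde a_i=[X_i,X_j]\tilde a_k\quad\text{for every } i,j,k=1,\dots,n.$$ Moreover, if $x_0\in M$, the solution $u:M\to\mathbb R$ of $\nabla_H u=\boldsymbol a$ can be obtained by $$u(x)=c_0+\int_0^1 g\big(\boldsymbol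 a(\gamma(t)),\dot\gamma(t)\big)\,dt,\qquad x\in M,$$ where $c_0=u(x_0)\in\mathbb R$ and $\gamma:[0,1]\to M$ is any horizontal curve joining $x_0$ with $x$.
   Context: A sub-Riemannian manifold $(M,\mathcal D,g)$ consists of a smooth connected manifold $M$, a smooth nonholonomic (bracket-generating) distribution $\mathcal D\subset TM$ (a subbundle of constant rank), and a Riemannian metric $g$ on $\mathcal D$. Here $\mathcal D$ has rank $n$ and $\dim M=n+1$; one has $[X_i,X_j]=c_{ij}\partial_{x_{n+1}}$, so $I_0\ne\emptyset$ makes $\mathcal D$ nonholonomic. All coordinate expressions ($\partial_{x_i}$, $A_i$, $X_i$, $c_{ij}$, $g_{ij}$, $a_i$, $\tilde a_j$) refer to the given coordinate system; vector fields act on functions as derivations, $X_kX_i f=X_k(X_i f)$, and $[X_i,X_j]=X_iX_j-X_jX_i$. $\mathcal F(M)$ is the set of smooth functions on $M$; $\Gamma(\mathcal D)$ is the set of (smooth) horizontal vector fields on $M$, i.e. vector fields with values in $\mathcal D$. For $u\in\mathcal F(M)$ the horizontal gradient $\nabla_Hu\in\Gamma(\mathcal D)$ is defined by $g(\nabla_Hu,X)=X(u)$ for every $X\in\Gamma(\mathcal D)$. A curve $\gamma:[0,1]\to M$ is horizontal if $\gamma\in W^{1,2}([0,1];M)$ and $\dot\gamma(t)\in\mathcal D(\gamma(t))$ for a.e. $t\in[0,1]$. *)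

theory Defs
  imports "HOL-Analysis.Analysis"
begin

primrec Ck_on :: "nat \<Rightarrow> 'v::real_normed_vector set \<Rightarrow> ('v \<Rightarrow> 'b::real_normed_vector) \<Rightarrow> bool" where
  "Ck_on 0 S f \<longleftrightarrow> continuous_on S f"
| "Ck_on (Suc k) S f \<longleftrightarrow>
     (\<forall>y\<in>S. f differentiable (at y)) \<and> (\<forall>v. Ck_on k S (\<lambda>y. frechet_derivative f (at y) v))"

definition smooth_on :: "'v::real_normed_vector set \<Rightarrow> ('v \<Rightarrow> 'b::real_normed_vector) \<Rightarrow> bool" where
  "smooth_on S f \<longleftrightarrow> (\<forall>k. Ck_on k S f)"

text \<open>
  A manifold is given by a subset M of a topological space together with coordinates x
  defined on all of M; its smooth structure is the one generated by the chart x.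
  Every tangent space is identified with the coordinate space 'v through the coordinate
  frame, so that a vector field is a function from points to vectors of components.
\<close>

definition global_chart :: "'m::topological_space set \<Rightarrow> ('m \<Rightarrow> 'v::euclidean_space) \<Rightarrow> bool" where
  "global_chart M x \<longleftrightarrow> open (x ` M) \<and> homeomorphism M (x ` M) x (inv_into M x)"

definition smooth_map ::
  "'m::topological_space set \<Rightarrow> ('m \<Rightarrow> 'v::euclidean_space) \<Rightarrow> ('m \<Rightarrow> 'b::real_normed_vector) \<Rightarrow> bool" where
  "smooth_map U x f \<longleftrightarrow> smooth_on (x ` U) (f \<circ> inv_into U x)"

text \<open>
  The derivation X f. It is defined for f with values in any normed space, so that vector
  fields also act componentwise.
\<close>

definition vf_act ::
  "'m::topological_space set \<Rightarrow> ('m \<Rightarrow> 'v::euclidean_space) \<Rightarrow> ('m \<Rightarrow> 'v) \<Rightarrow>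
   ('m \<Rightarrow> 'b::real_normed_vector) \<Rightarrow> 'm \<Rightarrow> 'b" where
  "vf_act M x X f p = frechet_derivative (f \<circ> inv_into M x) (at (x p)) (X p)"

definition commutator ::
  "'m::topological_space set \<Rightarrow> ('m \<Rightarrow> 'v::euclidean_space) \<Rightarrow> ('m \<Rightarrow> 'v) \<Rightarrow> ('m \<Rightarrow> 'v) \<Rightarrow>
   ('m \<Rightarrow> 'b::real_normed_vector) \<Rightarrow> 'm \<Rightarrow> 'b" where
  "commutator M x X Y f p = vf_act M x X (vf_act M x Y f) p - vf_act M x Y (vf_act M x X f) p"

definition smooth_distribution ::
  "'m::topological_space set \<Rightarrow> ('m \<Rightarrow> 'v::euclidean_space) \<Rightarrow> nat \<Rightarrow> ('m \<Rightarrow> 'v set) \<Rightarrow> bool" where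
  "smooth_distribution M x r D \<longleftrightarrow>
     (\<forall>p\<in>M. subspace (D p) \<and> dim (D p) = r) \<and>
     (\<forall>p\<in>M. \<exists>U Y. openin (top_of_set M) U \<and> p \<in> U \<and>
        (\<forall>k<r. smooth_map U x (Y k)) \<and> (\<forall>q\<in>U. D q = span ((\<lambda>k. Y k q) ` {..<r})))"

definition horizontal_fields ::
  "'m::topological_space set \<Rightarrow> ('m \<Rightarrow> 'v::euclidean_space) \<Rightarrow> ('m \<Rightarrow> 'v set) \<Rightarrow> ('m \<Rightarrow> 'v) set" where
  "horizontal_fields M x D = {X. smooth_map M x X \<and> (\<forall>p\<in>M. X p \<in> D p)}"

text \<open>
  The k-th component of a vector field Z is Z applied to the k-th coordinate function. Hence
  the bracket of X and Y, as a vector field, is the commutator applied to the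
  vector-valued coordinate map x.
\<close>

inductive_set iterated_brackets ::
  "'m::topological_space set \<Rightarrow> ('m \<Rightarrow> 'v::euclidean_space) \<Rightarrow> ('m \<Rightarrow> 'v set) \<Rightarrow> ('m \<Rightarrow> 'v) set"
  for M x D where
  horizontal: "X \<in> horizontal_fields M x D \<Longrightarrow> X \<in> iterated_brackets M x D"
| bracket: "X \<in> iterated_brackets M x D \<Longrightarrow> Y \<in> iterated_brackets M x D \<Longrightarrow>
    commutator M x X Y x \<in> iterated_brackets M x D"

definition nonholonomic ::
  "'m::topological_space set \<Rightarrow> ('m \<Rightarrow> 'v::euclidean_space) \<Rightarrow> ('m \<Rightarrow> 'v set) \<Rightarrow> bool" where
  "nonholonomic M x D \<longleftrightarrow> (\<forall>p\<in>M. span ((\<lambda>X. X p) ` iterated_brackets M x D) = UNIV)"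

text \<open>The values of g p outside D p are irrelevant.\<close>

definition metric_on_distribution ::
  "'m::topological_space set \<Rightarrow> ('m \<Rightarrow> 'v::euclidean_space) \<Rightarrow> ('m \<Rightarrow> 'v set) \<Rightarrow>
   ('m \<Rightarrow> 'v \<Rightarrow> 'v \<Rightarrow> real) \<Rightarrow> bool" where
  "metric_on_distribution M x D g \<longleftrightarrow>
     (\<forall>p\<in>M. \<forall>v\<in>D p. \<forall>w\<in>D p. g p v w = g p w v) \<and>
     (\<forall>p\<in>M. \<forall>v\<in>D p. \<forall>v'\<in>D p. \<forall>w\<in>D p. \<forall>s t.
        g p (s *\<^sub>R v + t *\<^sub>R v') w = s * g p v w + t * g p v' w) \<and>
     (\<forall>p\<in>M. \<forall>v\<in>D p. v \<noteq> 0 \<longrightarrow> g p v v > 0) \<and>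
     (\<forall>X\<in>horizontal_fields M x D. \<forall>Y\<in>horizontal_fields M x D.
        smooth_map M x (\<lambda>p. g p (X p) (Y p)))"

definition sub_riemannian ::
  "'m::topological_space set \<Rightarrow> ('m \<Rightarrow> 'v::euclidean_space) \<Rightarrow> nat \<Rightarrow> ('m \<Rightarrow> 'v set) \<Rightarrow>
   ('m \<Rightarrow> 'v \<Rightarrow> 'v \<Rightarrow> real) \<Rightarrow> bool" where
  "sub_riemannian M x r D g \<longleftrightarrow>
     global_chart M x \<and> connected M \<and> smooth_distribution M x r D \<and> nonholonomic M x D \<and>
     metric_on_distribution M x D g"

text \<open>The gradient is determined by this property on M, but is arbitrary outside M.\<close>

definition is_horizontal_gradient ::
  "'m::topological_space set \<Rightarrow> ('m \<Rightarrow> 'v::euclidean_space) \<Rightarrow> ('m \<Rightarrow> 'v set) \<Rightarrow>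
   ('m \<Rightarrow> 'v \<Rightarrow> 'v \<Rightarrow> real) \<Rightarrow> ('m \<Rightarrow> real) \<Rightarrow> ('m \<Rightarrow> 'v) \<Rightarrow> bool" where
  "is_horizontal_gradient M x D g u Z \<longleftrightarrow>
     Z \<in> horizontal_fields M x D \<and>
     (\<forall>X\<in>horizontal_fields M x D. \<forall>p\<in>M. g p (Z p) (X p) = vf_act M x X u p)"

definition gradient_solution ::
  "'m::topological_space set \<Rightarrow> ('m \<Rightarrow> 'v::euclidean_space) \<Rightarrow> ('m \<Rightarrow> 'v set) \<Rightarrow>
   ('m \<Rightarrow> 'v \<Rightarrow> 'v \<Rightarrow> real) \<Rightarrow> ('m \<Rightarrow> 'v) \<Rightarrow> ('m \<Rightarrow> real) \<Rightarrow> bool" where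
  "gradient_solution M x D g a u \<longleftrightarrow> smooth_map M x u \<and> is_horizontal_gradient M x D g u a"

definition L2_unit_interval :: "(real \<Rightarrow> 'v::euclidean_space) \<Rightarrow> bool" where
  "L2_unit_interval f \<longleftrightarrow>
     f \<in> borel_measurable (lebesgue_on {0..1}) \<and>
     integrable (lebesgue_on {0..1}) (\<lambda>t. (norm (f t))\<^sup>2)"

text \<open>
  The curve c belongs to the Sobolev space of order (1,2) on the unit interval and its weak
  derivative is v. As is common in dimension one, the test functions are the continuously
  differentiable functions with compact support in the open interval.
\<close>

definition W12_weak_derivative ::
  "(real \<Rightarrow> 'v::euclidean_space) \<Rightarrow> (real \<Rightarrow> 'v) \<Rightarrow> bool" where
  "W12_weak_derivative c v \<longleftrightarrow>
     L2_unit_interval c \<and> L2_unit_interval v \<and>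
     (\<forall>\<phi>::real \<Rightarrow> real. \<phi> C1_differentiable_on UNIV \<and>
        compact (closure {t. \<phi> t \<noteq> 0}) \<and> closure {t. \<phi> t \<noteq> 0} \<subseteq> {0<..<1} \<longrightarrow>
        (LINT t|lebesgue_on {0..1}. deriv \<phi> t *\<^sub>R c t) =
        - (LINT t|lebesgue_on {0..1}. \<phi> t *\<^sub>R v t))"

text \<open>
  A horizontal curve with velocity v. Sobolev curves are represented by their continuous
  representatives, so that their end points make sense.
\<close>

definition horizontal_curve ::
  "'m::topological_space set \<Rightarrow> ('m \<Rightarrow> 'v::euclidean_space) \<Rightarrow> ('m \<Rightarrow> 'v set) \<Rightarrow>
   (real \<Rightarrow> 'm) \<Rightarrow> (real \<Rightarrow> 'v) \<Rightarrow> bool" where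
  "horizontal_curve M x D \<gamma> v \<longleftrightarrow>
     path \<gamma> \<and> path_image \<gamma> \<subseteq> M \<and> W12_weak_derivative (x \<circ> \<gamma>) v \<and>
     (AE t in lebesgue_on {0..1}. v t \<in> D (\<gamma> t))"

text \<open>
  Coordinate vector fields for coordinates in the product of R^n and R: the first n
  coordinates form the first component and the last coordinate is the second component.
\<close>

definition coord_field :: "'n \<Rightarrow> 'm \<Rightarrow> (real ^ 'n::finite) \<times> real" where
  "coord_field i p = (axis i 1, 0)"

definition last_coord_field :: "'m \<Rightarrow> (real ^ 'n::finite) \<times> real" where
  "last_coord_field p = (0, 1)"

end

theory Submission
  imports Defs
begin

text \<open>
  In the chart, let \<open>f i\<close> be the coordinate expression of \<open>atilde i\<close>. A function \<open>u\<close> solves the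
  system iff \<open>X i u = f i\<close> for all \<open>i\<close>. Since \<open>[X i, X j] = c i j \<partial>\<close> with \<open>\<partial>\<close> the last coordinate
  field, which commutes with every \<open>X k\<close>, both conditions are necessary. Conversely, the first
  condition yields a function \<open>h\<close> with \<open>X i (f j) - X j (f i) = c i j h\<close>, the only candidate for
  \<open>\<partial> u\<close>, and the second one says \<open>X k h = \<partial> (f k)\<close>. Together they express that the one-form taking
  the values \<open>f i\<close> on \<open>X i\<close> and \<open>h\<close> on \<open>\<partial>\<close> is closed; hence it is exact on a simply connected domain.
  The integral formula is the fundamental theorem of calculus for \<open>u\<close> along an absolutely
  continuous curve.
\<close>

section \<open>Smooth functions\<close>

text \<open>Two gaps in regularity shape the proof. Simple connectedness supplies only continuous
  paths and homotopies, along which a one-form has no line integral. Line integrals are therefore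
  replaced by chain sums: inside a ball the closed form has increments \<open>d y z\<close>, its
  integrals over segments, and a path is measured by adding \<open>d\<close> over a fine
  subdivision. A grid on the homotopy square shows that the result depends on the end points alone.
  At the other end, a horizontal curve has only a weak derivative. Test functions close to
  indicators of intervals exhibit the curve as an indefinite integral, and estimates on short
  intervals take the place of the chain rule.

  Closedness can be read off from \<open>d\<omega>(Y, Z) = Y(\<omega> Z) - Z(\<omega> Y) -
  \<omega>([Y, Z])\<close>: the pair \<open>X i, X j\<close> gives
  \<open>X i (f j) - X j (f i) - c i j h\<close>, and the pair \<open>X k, \<partial>\<close> gives
  \<open>X k h - \<partial> (f k)\<close>. Dividing by one nonzero constant \<open>c k l\<close>
  defines \<open>h\<close>, and the second condition for that same pair \<open>k, l\<close> settles
  its derivatives.\<close>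

lemma frechet_derivative_eqI:
  "(f has_derivative f') (at y) \<Longrightarrow> frechet_derivative f (at y) v = f' v"
  using frechet_derivative_at by metis

text \<open>On an open set a derivative sees only values inside the set. The derivative formulas
  below hold on \<open>S\<close> only, so the closure rules for \<open>Ck_on\<close> pass through
  this congruence.\<close>

lemma Ck_on_cong:
  assumes "open S" "\<And>y. y \<in> S \<Longrightarrow> f y = g y" "Ck_on k S f"
  shows "Ck_on k S g"
  using assms(2,3)
proof (induction k arbitrary: f g)
  case 0
  then show ?case by (simp cong: continuous_on_cong)
next
  case (Suc k)
  note f = iffD1[OF Ck_on.simps(2) Suc.prems(2)]
  have d: "f differentiable (at y)" if "y \<in> S" for y
    using f that by blast
  have "g differentiable (at y)" if "y \<in> S" for y
    using d[OF that] Suc.prems(1) assms(1) that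
    unfolding differentiable_def by (blast intro: has_derivative_transform_within_open)
  moreover have eq: "frechet_derivative f (at y) = frechet_derivative g (at y)" if "y \<in> S" for y
    by (rule frechet_derivative_transform_within_open[OF d assms(1)]) (use that Suc.prems(1) in auto)
  have "Ck_on k S (\<lambda>y. frechet_derivative g (at y) v)" for v
    by (rule Suc.IH[of "\<lambda>y. frechet_derivative f (at y) v"]) (use f eq in auto)
  ultimately show ?case by simp
qed

lemma Ck_on_SucD: "Ck_on (Suc k) S f \<Longrightarrow> Ck_on k S f"
proof (induction k arbitrary: f)
  case 0
  then show ?case
    by (auto intro!: differentiable_imp_continuous_on differentiable_at_imp_differentiable_on)
next
  case (Suc k)
  note f = iffD1[OF Ck_on.simps(2) Suc.prems]
  have "Ck_on k S (\<lambda>y. frechet_derivative f (at y) v)" for v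
    by (rule Suc.IH) (use f in blast)
  with f show ?case by simp
qed

lemma Ck_on_const: "Ck_on k S (\<lambda>_. c)"
proof (induction k arbitrary: c)
  case (Suc k)
  then show ?case by simp
qed simp

lemma Ck_on_add:
  assumes "open S" "Ck_on k S f" "Ck_on k S g"
  shows "Ck_on k S (\<lambda>y. f y + g y)"
  using assms(2,3)
proof (induction k arbitrary: f g)
  case 0
  then show ?case by (simp add: continuous_on_add)
next
  case (Suc k)
  have eq: "frechet_derivative f (at y) v + frechet_derivative g (at y) v =
      frechet_derivative (\<lambda>y. f y + g y) (at y) v" if "y \<in> S" for y v
    by (rule frechet_derivative_eqI[symmetric], rule has_derivative_add)
       (use Suc.prems that in \<open>auto simp: frechet_derivative_works[symmetric]\<close>)
  have "Ck_on k S (\<lambda>y. frechet_derivative (\<lambda>y. f y + g y) (at y) v)" for v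
    using Suc.prems by (intro Ck_on_cong[OF assms(1) eq] Suc.IH) auto
  with Suc.prems show ?case by simp
qed

lemma Ck_on_bounded_bilinear:
  assumes "open S" "bounded_bilinear B" "Ck_on k S f" "Ck_on k S g"
  shows "Ck_on k S (\<lambda>y. B (f y) (g y))"
  using assms(3,4)
proof (induction k arbitrary: f g)
  case 0
  then show ?case by (simp add: bounded_bilinear.continuous_on[OF assms(2)])
next
  case (Suc k)
  have hd: "((\<lambda>y. B (f y) (g y)) has_derivative
      (\<lambda>v. B (f y) (frechet_derivative g (at y) v) + B (frechet_derivative f (at y) v) (g y))) (at y)"
    if "y \<in> S" for y
    by (rule bounded_bilinear.FDERIV[OF assms(2)]) (use Suc.prems that in \<open>auto simp: frechet_derivative_works[symmetric]\<close>)
  note eq = frechet_derivative_eqI[OF hd, symmetric]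
  \<comment> \<open>The Leibniz rule leaves one factor of each product undifferentiated, so
    \<open>f\<close> and \<open>g\<close> themselves are needed at level \<open>k\<close>;
    \<open>Ck_on_SucD\<close> lowers them.\<close>
  have "Ck_on k S (\<lambda>y. frechet_derivative (\<lambda>y. B (f y) (g y)) (at y) v)" for v
    using Suc.prems Ck_on_SucD[OF Suc.prems(1)] Ck_on_SucD[OF Suc.prems(2)]
    by (intro Ck_on_cong[OF assms(1) eq] Ck_on_add[OF assms(1)] Suc.IH) auto
  moreover have "(\<lambda>y. B (f y) (g y)) differentiable (at y)" if "y \<in> S" for y
    using hd[OF that] unfolding differentiable_def by blast
  ultimately show ?case by simp
qed

lemma Ck_on_bounded_linear:
  assumes "open S" "bounded_linear L" "Ck_on k S f"
  shows "Ck_on k S (\<lambda>y. L (f y))"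
  using assms(3)
proof (induction k arbitrary: f)
  case 0
  then show ?case by (simp add: bounded_linear.continuous_on[OF assms(2)])
next
  case (Suc k)
  have hd: "((\<lambda>y. L (f y)) has_derivative (\<lambda>v. L (frechet_derivative f (at y) v))) (at y)"
    if "y \<in> S" for y
    by (rule bounded_linear.has_derivative[OF assms(2)])
       (use Suc.prems that in \<open>auto simp: frechet_derivative_works[symmetric]\<close>)
  note eq = frechet_derivative_eqI[OF hd, symmetric]
  have "Ck_on k S (\<lambda>y. frechet_derivative (\<lambda>y. L (f y)) (at y) v)" for v
    using Suc.prems by (intro Ck_on_cong[OF assms(1) eq] Suc.IH) auto
  moreover have "(\<lambda>y. L (f y)) differentiable (at y)" if "y \<in> S" for y
    using hd[OF that] unfolding differentiable_def by blast
  ultimately show ?case by simp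
qed

lemma smooth_on_cong:
  "open S \<Longrightarrow> (\<And>y. y \<in> S \<Longrightarrow> f y = g y) \<Longrightarrow> smooth_on S f \<Longrightarrow> smooth_on S g"
  unfolding smooth_on_def using Ck_on_cong by metis

lemma smooth_on_const: "smooth_on S (\<lambda>_. c)"
  unfolding smooth_on_def by (simp add: Ck_on_const)

lemma smooth_on_add:
  "open S \<Longrightarrow> smooth_on S f \<Longrightarrow> smooth_on S g \<Longrightarrow> smooth_on S (\<lambda>y. f y + g y)"
  unfolding smooth_on_def by (simp add: Ck_on_add)

lemma smooth_on_mult:
  fixes f g :: "'v::real_normed_vector \<Rightarrow> real"
  shows "open S \<Longrightarrow> smooth_on S f \<Longrightarrow> smooth_on S g \<Longrightarrow> smooth_on S (\<lambda>y. f y * g y)"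
  unfolding smooth_on_def by (simp add: Ck_on_bounded_bilinear[OF _ bounded_bilinear_mult])

lemma smooth_on_bounded_linear:
  "open S \<Longrightarrow> bounded_linear L \<Longrightarrow> smooth_on S f \<Longrightarrow> smooth_on S (\<lambda>y. L (f y))"
  unfolding smooth_on_def by (simp add: Ck_on_bounded_linear)

lemma smooth_on_sum:
  assumes "open S" "\<And>i. i \<in> I \<Longrightarrow> smooth_on S (f i)"
  shows "smooth_on S (\<lambda>y. \<Sum>i\<in>I. f i y)"
  using assms(2)
proof (induction I rule: infinite_finite_induct)
  case (insert i I)
  then show ?case by (simp add: smooth_on_add[OF assms(1)])
qed (simp_all add: smooth_on_const)

lemma smooth_on_frechet_derivative:
  assumes "smooth_on S f"
  shows "smooth_on S (\<lambda>y. frechet_derivative f (at y) v)"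
  unfolding smooth_on_def
proof
  fix k
  have "Ck_on (Suc k) S f" using assms unfolding smooth_on_def by blast
  then show "Ck_on k S (\<lambda>y. frechet_derivative f (at y) v)" by simp
qed

lemma smooth_on_imp_continuous_on: "smooth_on S f \<Longrightarrow> continuous_on S f"
  unfolding smooth_on_def by (metis Ck_on.simps(1))

lemma smooth_on_has_derivative:
  assumes "smooth_on S f" "y \<in> S"
  shows "(f has_derivative frechet_derivative f (at y)) (at y)"
proof -
  have "Ck_on (Suc 0) S f" using assms(1) unfolding smooth_on_def by blast
  then show ?thesis using assms(2) frechet_derivative_works[of f] by simp
qed

text \<open>This is how a primitive of a smooth one-form is recognised as smooth: its differential
  is already known and smooth.\<close>

lemma smooth_onI:
  assumes "\<And>y. y \<in> S \<Longrightarrow> (f has_derivative f' y) (at y)" "open S" "\<And>v. smooth_on S (\<lambda>y. f' y v)"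
  shows "smooth_on S f"
  unfolding smooth_on_def
proof
  fix k
  have "Ck_on k S (\<lambda>y. frechet_derivative f (at y) v)" for v
    by (rule Ck_on_cong[OF assms(2) frechet_derivative_eqI[OF assms(1), symmetric]])
       (use assms(3) in \<open>auto simp: smooth_on_def\<close>)
  moreover have "f differentiable (at y)" if "y \<in> S" for y
    using assms(1)[OF that] unfolding differentiable_def by blast
  ultimately have "Ck_on (Suc k) S f" by simp
  then show "Ck_on k S f" by (rule Ck_on_SucD)
qed

text \<open>The core of Schwarz's theorem: the mean value theorem is applied in direction
  \<open>a\<close> to the difference taken in direction \<open>b\<close>, and then in direction
  \<open>b\<close> to the derivative. The left-hand side is symmetric in \<open>a\<close> and
  \<open>b\<close>, so exchanging them compares the two mixed derivatives at nearby points.\<close>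

lemma second_difference_mean_value:
  fixes f :: "'v::real_normed_vector \<Rightarrow> real"
  assumes f: "\<And>y. y \<in> ball p r \<Longrightarrow> (f has_derivative F y) (at y)"
    and Fa: "\<And>y. y \<in> ball p r \<Longrightarrow> ((\<lambda>y. F y a) has_derivative G y) (at y)"
    and s: "s > 0" "s * (norm a + norm b) < r"
  obtains y where "dist y p \<le> s * (norm a + norm b)"
    "f (p + s *\<^sub>R a + s *\<^sub>R b) - f (p + s *\<^sub>R a) - f (p + s *\<^sub>R b) + f p = s\<^sup>2 * G y b"
proof -
  have inb: "norm (\<alpha> *\<^sub>R a + \<beta> *\<^sub>R b) \<le> s * (norm a + norm b)"
    if "0 \<le> \<alpha>" "\<alpha> \<le> s" "0 \<le> \<beta>" "\<beta> \<le> s" for \<alpha> \<beta>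
  proof -
    have "norm (\<alpha> *\<^sub>R a + \<beta> *\<^sub>R b) \<le> \<alpha> * norm a + \<beta> * norm b"
      using that by (intro order_trans[OF norm_triangle_ineq]) simp
    also have "\<dots> \<le> s * norm a + s * norm b"
      using that by (intro add_mono mult_right_mono) auto
    finally show ?thesis by (simp add: algebra_simps)
  qed
  have ball: "p + \<alpha> *\<^sub>R a + \<beta> *\<^sub>R b \<in> ball p r"
    if "0 \<le> \<alpha>" "\<alpha> \<le> s" "0 \<le> \<beta>" "\<beta> \<le> s" for \<alpha> \<beta>
  proof -
    have "p - (p + \<alpha> *\<^sub>R a + \<beta> *\<^sub>R b) = - (\<alpha> *\<^sub>R a + \<beta> *\<^sub>R b)" by simp
    then show ?thesis
      using inb[OF that] s(2) by (simp only: mem_ball dist_norm norm_minus_cancel)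
  qed
  have f': "((\<lambda>\<alpha>. f (p + \<alpha> *\<^sub>R a + \<beta> *\<^sub>R b)) has_derivative
      (\<lambda>h. F (p + \<alpha> *\<^sub>R a + \<beta> *\<^sub>R b) (h *\<^sub>R a))) (at \<alpha> within T)"
    if "0 \<le> \<alpha>" "\<alpha> \<le> s" "0 \<le> \<beta>" "\<beta> \<le> s" for \<alpha> \<beta> T
    by (rule has_derivative_compose[where f = "\<lambda>\<alpha>. p + \<alpha> *\<^sub>R a + \<beta> *\<^sub>R b" and g = f, OF _ f[OF ball[OF that]]]) (auto intro!: derivative_eq_intros)
  have F': "((\<lambda>\<beta>. F (p + \<alpha> *\<^sub>R a + \<beta> *\<^sub>R b) a) has_derivative
      (\<lambda>h. G (p + \<alpha> *\<^sub>R a + \<beta> *\<^sub>R b) (h *\<^sub>R b))) (at \<beta> within T)"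
    if "0 \<le> \<alpha>" "\<alpha> \<le> s" "0 \<le> \<beta>" "\<beta> \<le> s" for \<alpha> \<beta> T
    by (rule has_derivative_compose[where f = "\<lambda>\<beta>. p + \<alpha> *\<^sub>R a + \<beta> *\<^sub>R b"
          and g = "\<lambda>y. F y a", OF _ Fa[OF ball[OF that]]]) (auto intro!: derivative_eq_intros)
  have "\<exists>\<alpha>\<in>{0<..<s}. (f (p + s *\<^sub>R a + s *\<^sub>R b) - f (p + s *\<^sub>R a + 0 *\<^sub>R b))
      - (f (p + 0 *\<^sub>R a + s *\<^sub>R b) - f (p + 0 *\<^sub>R a + 0 *\<^sub>R b))
      = F (p + \<alpha> *\<^sub>R a + s *\<^sub>R b) ((s - 0) *\<^sub>R a) - F (p + \<alpha> *\<^sub>R a + 0 *\<^sub>R b) ((s - 0) *\<^sub>R a)"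
    using s by (intro mvt_simple has_derivative_diff f') auto
  then obtain \<alpha> where \<alpha>: "0 < \<alpha>" "\<alpha> < s" and
    1: "f (p + s *\<^sub>R a + s *\<^sub>R b) - f (p + s *\<^sub>R a) - f (p + s *\<^sub>R b) + f p =
      F (p + \<alpha> *\<^sub>R a + s *\<^sub>R b) (s *\<^sub>R a) - F (p + \<alpha> *\<^sub>R a) (s *\<^sub>R a)" by auto
  have "\<exists>\<beta>\<in>{0<..<s}. F (p + \<alpha> *\<^sub>R a + s *\<^sub>R b) a - F (p + \<alpha> *\<^sub>R a + 0 *\<^sub>R b) a
      = G (p + \<alpha> *\<^sub>R a + \<beta> *\<^sub>R b) ((s - 0) *\<^sub>R b)"
    using s \<alpha> by (intro mvt_simple F') auto
  then obtain \<beta> where \<beta>: "0 < \<beta>" "\<beta> < s" and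
    2: "F (p + \<alpha> *\<^sub>R a + s *\<^sub>R b) a - F (p + \<alpha> *\<^sub>R a) a = G (p + \<alpha> *\<^sub>R a + \<beta> *\<^sub>R b) (s *\<^sub>R b)"
    by auto
  have lin: "F y (s *\<^sub>R a) = s * F y a" "G y (s *\<^sub>R b) = s * G y b" if "y \<in> ball p r" for y
    using linear_cmul[OF has_derivative_linear[OF f[OF that]]]
      linear_cmul[OF has_derivative_linear[OF Fa[OF that]]] by auto
  show ?thesis
  proof
    show "dist (p + \<alpha> *\<^sub>R a + \<beta> *\<^sub>R b) p \<le> s * (norm a + norm b)"
      using inb[of \<alpha> \<beta>] \<alpha> \<beta> by (simp add: dist_norm add.assoc)
    have "F (p + \<alpha> *\<^sub>R a + s *\<^sub>R b) (s *\<^sub>R a) - F (p + \<alpha> *\<^sub>R a) (s *\<^sub>R a) =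
       s * (F (p + \<alpha> *\<^sub>R a + s *\<^sub>R b) a - F (p + \<alpha> *\<^sub>R a) a)"
      using lin(1)[OF ball[of \<alpha> s]] lin(1)[OF ball[of \<alpha> 0]] \<alpha> s by (simp add: right_diff_distrib)
    then show "f (p + s *\<^sub>R a + s *\<^sub>R b) - f (p + s *\<^sub>R a) - f (p + s *\<^sub>R b) + f p =
        s\<^sup>2 * G (p + \<alpha> *\<^sub>R a + \<beta> *\<^sub>R b) b"
      unfolding 1 2 using lin(2)[OF ball[of \<alpha> \<beta>]] \<alpha> \<beta> by (simp add: power2_eq_square)
  qed
qed

lemma smooth_on_mixed_derivatives:
  fixes f :: "'v::real_normed_vector \<Rightarrow> real"
  assumes S: "open S" and f: "smooth_on S f" and p: "p \<in> S"
  shows "frechet_derivative (\<lambda>y. frechet_derivative f (at y) a) (at p) b =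
         frechet_derivative (\<lambda>y. frechet_derivative f (at y) b) (at p) a"
proof -
  define F where "F = (\<lambda>y. frechet_derivative f (at y))"
  define G where "G = (\<lambda>a y. frechet_derivative (\<lambda>y. F y a) (at y))"
  obtain r where r: "r > 0" "ball p r \<subseteq> S"
    using S p open_contains_ball by blast
  have F: "(f has_derivative F y) (at y)" if "y \<in> ball p r" for y
    unfolding F_def using smooth_on_has_derivative[OF f] r that by blast
  have G: "((\<lambda>y. F y a) has_derivative G a y) (at y)" if "y \<in> ball p r" for a y
    unfolding F_def G_def
    using smooth_on_has_derivative[OF smooth_on_frechet_derivative[OF f]] r that by blast
  have contG: "isCont (\<lambda>y. G a y b) p" for a b
    using smooth_on_imp_continuous_on[OF smooth_on_frechet_derivative[OF
        smooth_on_frechet_derivative[OF f]]] S p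
    unfolding G_def F_def by (simp add: continuous_on_eq_continuous_at)
  have "\<bar>G a p b - G b p a\<bar> \<le> e" if e: "e > 0" for e
  proof -
    obtain d1 where d1: "d1 > 0" "\<And>y. dist y p < d1 \<Longrightarrow> \<bar>G a y b - G a p b\<bar> < e/2"
      using contG[of a b] e unfolding continuous_at dist_real_def
      by (metis continuous_at_eps_delta contG dist_real_def half_gt_zero)
    obtain d2 where d2: "d2 > 0" "\<And>y. dist y p < d2 \<Longrightarrow> \<bar>G b y a - G b p a\<bar> < e/2"
      by (metis continuous_at_eps_delta contG dist_real_def half_gt_zero e)
    define m where "m = min r (min d1 d2)"
    \<comment> \<open>The summand 1 keeps the denominator positive even if \<open>a\<close> and
      \<open>b\<close> both vanish, and it makes the inequality \<open>sm\<close> strict.\<close>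
    define s where "s = m / (norm a + norm b + 1)"
    have m: "m > 0" unfolding m_def using r d1 d2 by simp
    have s: "s > 0" unfolding s_def using m by (intro divide_pos_pos) (auto simp: add_nonneg_pos)
    have sm: "s * (norm a + norm b) < m"
    proof -
      have "m * (norm a + norm b) < m * (norm a + norm b + 1)" using m by simp
      then show ?thesis unfolding s_def by (simp add: divide_less_eq add_nonneg_pos)
    qed
    obtain y where y: "dist y p \<le> s * (norm a + norm b)"
      "f (p + s *\<^sub>R a + s *\<^sub>R b) - f (p + s *\<^sub>R a) - f (p + s *\<^sub>R b) + f p = s\<^sup>2 * G a y b"
      using second_difference_mean_value[of p r f F a "G a" s b, OF F G s] sm unfolding m_def by auto
    obtain z where z: "dist z p \<le> s * (norm b + norm a)"
      "f (p + s *\<^sub>R b + s *\<^sub>R a) - f (p + s *\<^sub>R b) - f (p + s *\<^sub>R a) + f p = s\<^sup>2 * G b z a"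
      using second_difference_mean_value[of p r f F b "G b" s a, OF F G s] sm unfolding m_def
      by (auto simp: add.commute)
    have eq: "p + s *\<^sub>R a + s *\<^sub>R b = p + s *\<^sub>R b + s *\<^sub>R a" by (simp add: ac_simps)
    have "s\<^sup>2 * G a y b = s\<^sup>2 * G b z a" using y(2) z(2) unfolding eq by linarith
    then have "G a y b = G b z a" using s by simp
    moreover have "\<bar>G a y b - G a p b\<bar> < e/2" "\<bar>G b z a - G b p a\<bar> < e/2"
      by (rule d1(2) d2(2), use y(1) z(1) sm m_def in \<open>simp add: add.commute\<close>)+
    ultimately show ?thesis by linarith
  qed
  then have "\<bar>G a p b - G b p a\<bar> \<le> 0" by (rule field_le_epsilon[of _ 0, simplified])
  then show ?thesis unfolding G_def F_def by simp
qed

section \<open>Locally additive functions on simply connected sets\<close>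

text \<open>A discrete line integral over \<open>N\<close> equal pieces of the parameter interval;
  it makes sense for paths that are merely continuous.\<close>

definition chain_sum :: "('a \<Rightarrow> 'a \<Rightarrow> real) \<Rightarrow> (real \<Rightarrow> 'a) \<Rightarrow> nat \<Rightarrow> real" where
  "chain_sum d p N = (\<Sum>k<N. d (p (real k / real N)) (p (real (Suc k) / real N)))"

text \<open>On \<open>U\<close> the function \<open>d\<close> behaves like the differences of a
  potential. Taking all three points equal gives \<open>d x x = 0\<close>.\<close>

definition additive_within :: "'a set \<Rightarrow> ('a \<Rightarrow> 'a \<Rightarrow> real) \<Rightarrow> bool" where
  "additive_within U d \<longleftrightarrow> (\<forall>x\<in>U. \<forall>y\<in>U. \<forall>z\<in>U. d x y + d y z = d x z)"

lemma additive_withinD: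
  "additive_within U d \<Longrightarrow> x \<in> U \<Longrightarrow> y \<in> U \<Longrightarrow> z \<in> U \<Longrightarrow> d x y + d y z = d x z"
  unfolding additive_within_def by blast

text \<open>The square is cut into \<open>N * N\<close> cells. A cell has diameter at most
  \<open>1 / N + 1 / N\<close>, hence its corners map into one set on which \<open>d\<close> is
  additive, and the two ways round it give the same sum. Moving across the grid row by row changes
  nothing, because the two sides of the square are mapped to single points.\<close>

lemma chain_sum_grid_eq:
  fixes h :: "real \<times> real \<Rightarrow> 'a"
  assumes cell: "\<And>s t. s \<in> {0..1} \<Longrightarrow> t \<in> {0..1} \<Longrightarrow> \<exists>G. additive_within G d \<and>
      (\<forall>s'\<in>{0..1}. \<forall>t'\<in>{0..1}. dist (s, t) (s', t') < \<delta> \<longrightarrow> h (s', t') \<in> G)"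
    and ends: "\<And>s. s \<in> {0..1} \<Longrightarrow> h (s, 0) = x" "\<And>s. s \<in> {0..1} \<Longrightarrow> h (s, 1) = y"
    and N: "N > 0" "2 / real N < \<delta>"
  shows "chain_sum d (\<lambda>t. h (0, t)) N = chain_sum d (\<lambda>t. h (1, t)) N"
proof -
  define P where "P = (\<lambda>j k. h (real j / real N, real k / real N))"
  have step: "d (P j k) (P j (Suc k)) + d (P j (Suc k)) (P (Suc j) (Suc k)) =
      d (P j k) (P (Suc j) k) + d (P (Suc j) k) (P (Suc j) (Suc k))" if "j < N" "k < N" for j k
  proof -
    have I: "real i / real N \<in> {0..1}" if "i \<le> N" for i using that N by auto
    from cell[OF I I, of j k] that obtain G where G: "additive_within G d"
      "\<And>s' t'. s' \<in> {0..1} \<Longrightarrow> t' \<in> {0..1} \<Longrightarrow>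
         dist (real j / real N, real k / real N) (s', t') < \<delta> \<Longrightarrow> h (s', t') \<in> G"
      by (meson less_or_eq_imp_le)
    have "P j' k' \<in> G" if "j' \<in> {j, Suc j}" "k' \<in> {k, Suc k}" for j' k'
      unfolding P_def
    proof (rule G(2))
      have close: "dist (real i / real N) (real i' / real N) \<le> 1 / real N" if "i' \<in> {i, Suc i}" for i i'
        using that N(1) by (auto simp: dist_real_def diff_divide_distrib[symmetric])
      have "dist (real j / real N, real k / real N) (real j' / real N, real k' / real N) \<le>
          dist (real j / real N) (real j' / real N) + dist (real k / real N) (real k' / real N)"
        unfolding dist_Pair_Pair by (rule sqrt_sum_squares_le_sum) auto
      also have "\<dots> \<le> 1 / real N + 1 / real N" by (intro add_mono close that)
      also have "\<dots> < \<delta>" using N(2) by simp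
      finally show "dist (real j / real N, real k / real N) (real j' / real N, real k' / real N) < \<delta>" .
    qed (use I \<open>j < N\<close> \<open>k < N\<close> that in auto)
    then show ?thesis by (simp add: additive_withinD[OF G(1)])
  qed
  have "chain_sum d (\<lambda>t. h (real j / real N, t)) N = chain_sum d (\<lambda>t. h (0, t)) N" if "j \<le> N" for j
    using that
  proof (induction j)
    case (Suc j)
    have ends_eq: "P j k = P (Suc j) k" if "k = 0 \<or> k = N" for k
    proof -
      have "real j / real N \<in> {0..1}" "real (Suc j) / real N \<in> {0..1}" using Suc.prems N by auto
      then show ?thesis using that ends N unfolding P_def by (auto simp: zero_less_iff_neq_zero)
    qed
    have zero: "d (P j k) (P j k) = 0" if "k \<le> N" for k
    proof -
      have "real j / real N \<in> {0..1}" "real k / real N \<in> {0..1}" using Suc.prems N that by auto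
      from cell[OF this] obtain G where "additive_within G d" "P j k \<in> G"
        unfolding P_def using N
        by (metis (no_types, lifting) \<open>real j / real N \<in> {0..1}\<close> \<open>real k / real N \<in> {0..1}\<close> dist_self
            divide_nonneg_nonneg le_less_trans of_nat_0_le_iff zero_le_numeral)
      then show ?thesis using additive_withinD[of G d "P j k" "P j k" "P j k"] by simp
    qed
    \<comment> \<open>Adding the cell identities along a row leaves only the edges joining row
      \<open>j\<close> to row \<open>Suc j\<close>. These telescope to the two outermost ones, which
      are constant and contribute \<open>d x x = 0\<close>.\<close>
    have "(\<Sum>k<N. d (P j k) (P j (Suc k))) - (\<Sum>k<N. d (P (Suc j) k) (P (Suc j) (Suc k))) =
        (\<Sum>k<N. d (P j k) (P (Suc j) k) - d (P j (Suc k)) (P (Suc j) (Suc k)))"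
      unfolding sum_subtractf[symmetric] using step Suc.prems by (intro sum.cong) (auto simp: algebra_simps)
    also have "\<dots> = d (P j 0) (P (Suc j) 0) - d (P j N) (P (Suc j) N)"
      by (rule sum_lessThan_telescope')
    also have "\<dots> = 0"
      using ends_eq[symmetric] zero by simp
    finally show ?case using Suc unfolding chain_sum_def P_def by simp
  qed simp
  from this[of N] N show ?thesis by simp
qed

lemma chain_sum_cong:
  assumes "\<And>t. t \<in> {0..1} \<Longrightarrow> p t = q t"
  shows "chain_sum d p N = chain_sum d q N"
  unfolding chain_sum_def by (intro sum.cong refl arg_cong2[where f = d] assms) auto

text \<open>The Lebesgue number \<open>\<epsilon>\<close> of the cover of the compact image by balls
  of additivity, together with uniform continuity of the homotopy, gives the mesh
  \<open>\<delta>\<close> required for the grid.\<close>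

lemma chain_sum_homotopic:
  fixes S :: "'a::metric_space set"
  assumes S: "\<And>x. x \<in> S \<Longrightarrow> \<exists>r>0. additive_within (ball x r) d"
    and pq: "homotopic_paths S p q"
  shows "\<forall>\<^sub>F N in sequentially. chain_sum d p N = chain_sum d q N"
proof -
  obtain h where h: "continuous_on ({0..1} \<times> {0..1}) h" "h \<in> ({0..1} \<times> {0..1}) \<rightarrow> S"
    "\<And>t. t \<in> {0..1} \<Longrightarrow> h (0, t) = p t" "\<And>t. t \<in> {0..1} \<Longrightarrow> h (1, t) = q t"
    "\<And>s. s \<in> {0..1::real} \<Longrightarrow> h (s, 0) = p 0 \<and> h (s, 1) = p 1"
    using pq unfolding homotopic_paths by (auto simp: pathstart_def pathfinish_def)
  have K: "compact (h ` ({0..1} \<times> {0..1}))"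
    by (intro compact_continuous_image h(1) compact_Times) auto
  obtain \<epsilon> where \<epsilon>: "\<epsilon> > 0"
    "\<And>x. x \<in> h ` ({0..1} \<times> {0..1}) \<Longrightarrow> \<exists>G\<in>{ball x r |x r. additive_within (ball x r) d}. ball x \<epsilon> \<subseteq> G"
  proof (rule Heine_Borel_lemma[OF K])
    show "h ` ({0..1} \<times> {0..1}) \<subseteq> \<Union> {ball x r |x r. additive_within (ball x r) d}"
    proof
      fix y assume "y \<in> h ` ({0..1} \<times> {0..1})"
      then have "y \<in> S" using h(2) by auto
      then obtain r where "r > 0" "additive_within (ball y r) d" using S by blast
      then show "y \<in> \<Union> {ball x r |x r. additive_within (ball x r) d}"
        by (intro UnionI[of "ball y r"]) auto
    qed
  qed auto
  have "uniformly_continuous_on ({0..1} \<times> {0..1}) h"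
    by (intro compact_uniformly_continuous h(1) compact_Times) auto
  then obtain \<delta> where \<delta>: "\<delta> > 0" "\<And>z z'. z \<in> {0..1} \<times> {0..1} \<Longrightarrow> z' \<in> {0..1} \<times> {0..1} \<Longrightarrow>
      dist z' z < \<delta> \<Longrightarrow> dist (h z') (h z) < \<epsilon>"
    unfolding uniformly_continuous_on_def using \<epsilon>(1) by metis
  have cell: "\<exists>G. additive_within G d \<and>
      (\<forall>s'\<in>{0..1}. \<forall>t'\<in>{0..1}. dist (s, t) (s', t') < \<delta> \<longrightarrow> h (s', t') \<in> G)"
    if "s \<in> {0..1}" "t \<in> {0..1}" for s t
  proof -
    have "h (s, t) \<in> h ` ({0..1} \<times> {0..1})" using that by blast
    from \<epsilon>(2)[OF this] obtain G where G: "additive_within G d" "ball (h (s, t)) \<epsilon> \<subseteq> G"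
      by blast
    have "h (s', t') \<in> G" if "s' \<in> {0..1}" "t' \<in> {0..1}" "dist (s, t) (s', t') < \<delta>" for s' t'
      using \<delta>(2)[of "(s', t')" "(s, t)"] that \<open>s \<in> {0..1}\<close> \<open>t \<in> {0..1}\<close> G(2) by (auto simp: subset_iff)
    then show ?thesis using G(1) by blast
  qed
  have "((\<lambda>N. 2 / real N) \<longlongrightarrow> 0) sequentially"
    by (rule lim_const_over_n)
  then have "\<forall>\<^sub>F N in sequentially. 2 / real N < \<delta>"
    using \<delta>(1) order_tendstoD(2) by blast
  then show ?thesis
    using eventually_gt_at_top[of "0::nat"]
  proof eventually_elim
    case (elim N)
    have "chain_sum d p N = chain_sum d (\<lambda>t. h (0, t)) N"
      by (rule chain_sum_cong) (simp add: h(3))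
    also have "\<dots> = chain_sum d (\<lambda>t. h (1, t)) N"
      using cell h(5) elim by (intro chain_sum_grid_eq[where \<delta> = \<delta> and x = "p 0" and y = "p 1"]) auto
    also have "\<dots> = chain_sum d q N"
      by (rule chain_sum_cong) (simp add: h(4))
    finally show ?case .
  qed
qed

lemma chain_sum_joinpaths:
  assumes "pathfinish p = pathstart q"
  shows "chain_sum d (p +++ q) (2 * N) = chain_sum d p N + chain_sum d q N"
proof (cases "N = 0")
  case False
  have split: "(\<Sum>k<N + m. f k) = (\<Sum>k<N. f k) + (\<Sum>k<m. f (N + k))" for f :: "nat \<Rightarrow> real" and m
    by (induction m) (simp_all add: add.assoc)
  have "chain_sum d (p +++ q) (2 * N) =
      (\<Sum>k<N. d ((p +++ q) (real k / real (2 * N))) ((p +++ q) (real (Suc k) / real (2 * N)))) +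
      (\<Sum>k<N. d ((p +++ q) (real (N + k) / real (2 * N))) ((p +++ q) (real (Suc (N + k)) / real (2 * N))))"
    unfolding chain_sum_def mult_2 by (rule split)
  also have "(\<Sum>k<N. d ((p +++ q) (real k / real (2 * N))) ((p +++ q) (real (Suc k) / real (2 * N)))) =
      chain_sum d p N"
  proof -
    have "(p +++ q) (real k / real (2 * N)) = p (real k / real N)" if "k \<le> N" for k
    proof -
      have "2 * (real k / real (2 * N)) = real k / real N" "real k / real (2 * N) \<le> 1/2"
        using that False by (auto simp: field_simps)
      then show ?thesis by (simp only: joinpaths_def if_True)
    qed
    then show ?thesis unfolding chain_sum_def by (intro sum.cong) (simp_all del: of_nat_Suc)
  qed
  also have "(\<Sum>k<N. d ((p +++ q) (real (N + k) / real (2 * N))) ((p +++ q) (real (Suc (N + k)) / real (2 * N)))) =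
      chain_sum d q N"
  proof -
    \<comment> \<open>At \<open>k = 0\<close> the parameter is 1/2, where the join is evaluated on
      \<open>p\<close>; the matching end points turn that value into \<open>q 0\<close>.\<close>
    have "(p +++ q) (real (N + k) / real (2 * N)) = q (real k / real N)" for k
    proof -
      have "real (N + k) / real (2 * N) = 1/2 + (real k / real N) / 2" using False by (simp add: field_simps)
      then show ?thesis
        using assms False by (auto simp: joinpaths_def pathfinish_def pathstart_def divide_le_0_iff)
    qed
    from this this[of "Suc _"] show ?thesis unfolding chain_sum_def add_Suc_right by (simp del: of_nat_Suc)
  qed
  finally show ?thesis .
qed (simp add: chain_sum_def)

text \<open>Convexity keeps every subdivision point in \<open>U\<close>, so additivity collapses the
  partial sums.\<close>

lemma chain_sum_linepath:
  assumes U: "additive_within U d" "convex U" "y \<in> U" "z \<in> U" and N: "N > 0"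
  shows "chain_sum d (linepath y z) N = d y z"
proof -
  have inU: "linepath y z (real k / real N) \<in> U" if "k \<le> N" for k
  proof -
    have "linepath y z (real k / real N) \<in> closed_segment y z"
      using that N by (intro linepath_in_path) auto
    then show ?thesis using closed_segment_subset[OF U(3,4,2)] by blast
  qed
  have "(\<Sum>k<m. d (linepath y z (real k / real N)) (linepath y z (real (Suc k) / real N))) =
      d y (linepath y z (real m / real N))" if "m \<le> N" for m
    using that
  proof (induction m)
    case 0
    show ?case using additive_withinD[OF U(1,3,3,3)] by (simp add: linepath_def)
  next
    case (Suc m)
    then show ?case
      using additive_withinD[OF U(1,3) inU[of m] inU[of "Suc m"]] by simp
  qed
  from this[of N] N show ?thesis unfolding chain_sum_def by (simp add: linepath_def)
qed

text \<open>
  Dyadic subdivisions make the chain sums compatible with joining paths: halving the parameter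
  interval of a joined path reproduces the dyadic subdivisions of its two parts.
\<close>

lemma simply_connected_additive_primitive:
  fixes S :: "'a::real_normed_vector set"
  assumes S: "simply_connected S"
    and d: "\<And>x. x \<in> S \<Longrightarrow> \<exists>r>0. ball x r \<subseteq> S \<and> additive_within (ball x r) d"
  obtains u where "\<And>x. x \<in> S \<Longrightarrow> \<exists>r>0. \<forall>y\<in>ball x r. \<forall>z\<in>ball x r. u z = u y + d y z"
proof (cases "S = {}")
  case True
  then show ?thesis using that[of "\<lambda>_. 0"] by simp
next
  case False
  then obtain x0 where x0: "x0 \<in> S" by blast
  have homot: "homotopic_paths S p q"
    if "path p" "path_image p \<subseteq> S" "path q" "path_image q \<subseteq> S"
      "pathstart q = pathstart p" "pathfinish q = pathfinish p" for p q
    using S that unfolding simply_connected_eq_homotopic_paths by blast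
  have "\<exists>p. path p \<and> path_image p \<subseteq> S \<and> pathstart p = x0 \<and> pathfinish p = y" if "y \<in> S" for y
    using simply_connected_imp_path_connected[OF S] x0 that unfolding path_connected_def by blast
  then obtain \<gamma> where \<gamma>: "\<And>y. y \<in> S \<Longrightarrow> path (\<gamma> y)" "\<And>y. y \<in> S \<Longrightarrow> path_image (\<gamma> y) \<subseteq> S"
    "\<And>y. y \<in> S \<Longrightarrow> pathstart (\<gamma> y) = x0" "\<And>y. y \<in> S \<Longrightarrow> pathfinish (\<gamma> y) = y"
    by metis
  have pow: "filterlim (\<lambda>m. 2 ^ m :: nat) sequentially sequentially"
    by (rule filterlim_subseq) (simp add: strict_mono_def)
  \<comment> \<open>The path to \<open>z\<close> is homotopic to the path to \<open>y\<close>
    prolonged by a segment. Splitting the join evenly doubles the number of pieces, hence level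
    \<open>Suc m\<close> at \<open>z\<close> against level \<open>m\<close> at \<open>y\<close>; the
    shift disappears in the eventual values.\<close>
  have step: "\<forall>\<^sub>F m in sequentially. chain_sum d (\<gamma> z) (2 ^ Suc m) = chain_sum d (\<gamma> y) (2 ^ m) + d y z"
    if r: "ball x r \<subseteq> S" "additive_within (ball x r) d" and yz: "y \<in> ball x r" "z \<in> ball x r" for x y z r
  proof -
    have yS: "y \<in> S" "z \<in> S" using that by auto
    have seg: "closed_segment y z \<subseteq> S"
      using closed_segment_subset[OF yz convex_ball] r(1) by blast
    have "homotopic_paths S (\<gamma> z) (\<gamma> y +++ linepath y z)"
      using \<gamma> yS seg by (intro homot) (auto simp: path_image_join)
    then have "\<forall>\<^sub>F N in sequentially. chain_sum d (\<gamma> z) N = chain_sum d (\<gamma> y +++ linepath y z) N"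
      by (rule chain_sum_homotopic[rotated]) (use d in blast)
    then have "\<forall>\<^sub>F m in sequentially. chain_sum d (\<gamma> z) (2 ^ Suc m) =
        chain_sum d (\<gamma> y +++ linepath y z) (2 ^ Suc m)"
      using filterlim_iff[THEN iffD1, OF pow] eventually_sequentially_Suc[of "\<lambda>m. chain_sum d (\<gamma> z) (2 ^ m) =
        chain_sum d (\<gamma> y +++ linepath y z) (2 ^ m)"] by blast
    then show ?thesis
      by eventually_elim (use \<gamma>(4) yS in
        \<open>simp add: chain_sum_joinpaths chain_sum_linepath[OF r(2) convex_ball yz]\<close>)
  qed
  \<comment> \<open>With \<open>z = y\<close>, the fact \<open>step\<close> compares consecutive
    dyadic levels of one path: their sums eventually agree, so the sequence is eventually constant
    and its eventual value can serve as \<open>u y\<close>.\<close>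
  have "\<exists>L. \<forall>\<^sub>F m in sequentially. chain_sum d (\<gamma> y) (2 ^ m) = L" if "y \<in> S" for y
  proof -
    obtain r where r: "r > 0" "ball y r \<subseteq> S" "additive_within (ball y r) d"
      using d[OF \<open>y \<in> S\<close>] by blast
    have "d y y = 0" using additive_withinD[OF r(3), of y y y] r(1) by simp
    then obtain M where M: "\<And>m. m \<ge> M \<Longrightarrow> chain_sum d (\<gamma> y) (2 ^ Suc m) = chain_sum d (\<gamma> y) (2 ^ m)"
      using step[OF r(2,3), of y y] r(1) unfolding eventually_sequentially by auto
    have "chain_sum d (\<gamma> y) (2 ^ m) = chain_sum d (\<gamma> y) (2 ^ M)" if "m \<ge> M" for m
      using that by (induction m rule: dec_induct) (use M in auto)
    then show ?thesis unfolding eventually_sequentially by blast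
  qed
  then obtain u where u: "\<And>y. y \<in> S \<Longrightarrow> \<forall>\<^sub>F m in sequentially. chain_sum d (\<gamma> y) (2 ^ m) = u y"
    by metis
  show ?thesis
  proof (rule that)
    fix x assume "x \<in> S"
    then obtain r where r: "r > 0" "ball x r \<subseteq> S" "additive_within (ball x r) d" using d by blast
    have "u z = u y + d y z" if "y \<in> ball x r" "z \<in> ball x r" for y z
    proof -
      have "\<forall>\<^sub>F m in sequentially. chain_sum d (\<gamma> z) (2 ^ Suc m) = u z"
        using u[of z] r(2) that unfolding eventually_sequentially_Suc[of "\<lambda>m. chain_sum d (\<gamma> z) (2 ^ m) = u z"] by blast
      moreover have "\<forall>\<^sub>F m in sequentially. chain_sum d (\<gamma> y) (2 ^ m) = u y"
        using u[of y] r(2) that by blast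
      ultimately have "\<forall>\<^sub>F m in sequentially. u z = u y + d y z"
        using step[OF r(2,3) that] by eventually_elim simp
      then show ?thesis by simp
    qed
    then show "\<exists>r>0. \<forall>y\<in>ball x r. \<forall>z\<in>ball x r. u z = u y + d y z" using r(1) by blast
  qed
qed

section \<open>Closed one-forms\<close>

text \<open>Stokes' theorem on the triangle \<open>y\<close>, \<open>z\<close>, \<open>w\<close>.
  \<open>F s\<close> integrates the form over the segment from \<open>y\<close> to the point
  \<open>Z s\<close> of the opposite side. Its derivative turns out to be
  \<open>W (Z s) \<bullet> (w - z)\<close>, so \<open>F 1 - F 0\<close> is the integral over that
  side.\<close>

lemma additive_within_closed_form:
  fixes W :: "'a::euclidean_space \<Rightarrow> 'a"
  assumes U: "convex U"
    and W: "\<And>y. y \<in> U \<Longrightarrow> (W has_derivative W' y) (at y)"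
    and contW': "\<And>v. continuous_on U (\<lambda>y. W' y v)"
    and sym: "\<And>y v w. y \<in> U \<Longrightarrow> W' y v \<bullet> w = W' y w \<bullet> v"
  shows "additive_within U (\<lambda>y z. integral {0..1} (\<lambda>t. W (y + t *\<^sub>R (z - y)) \<bullet> (z - y)))"
  unfolding additive_within_def
proof (intro ballI)
  fix y z w assume yzw: "y \<in> U" "z \<in> U" "w \<in> U"
  define Z where "Z = (\<lambda>s. z + s *\<^sub>R (w - z))"
  define P where "P = (\<lambda>s t. y + t *\<^sub>R (Z s - y))"
  define \<phi> where "\<phi> = (\<lambda>s t. W (P s t) \<bullet> (Z s - y))"
  define \<phi>' where "\<phi>' = (\<lambda>s t. W (P s t) \<bullet> (w - z) + t * (W' (P s t) (w - z) \<bullet> (Z s - y)))"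
  define F where "F = (\<lambda>s. integral {0..1} (\<phi> s))"
  have contW: "continuous_on U W"
    using W has_derivative_continuous continuous_at_imp_continuous_on by metis
  have segU: "a + t *\<^sub>R (b - a) \<in> U" if "a \<in> U" "b \<in> U" "t \<in> {0..1}" for a b t
    using convexD[OF U that(1,2), of "1 - t" t] that(3) by (simp add: algebra_simps)
  have ZU: "Z s \<in> U" if "s \<in> {0..1}" for s
    unfolding Z_def by (intro segU yzw that)
  have PU: "P s t \<in> U" if "s \<in> {0..1}" "t \<in> {0..1}" for s t
    unfolding P_def by (intro segU yzw ZU that)
  have dZ: "(Z has_vector_derivative (w - z)) (at s within T)" for s T
    unfolding Z_def by (auto intro!: derivative_eq_intros)
  have dPs: "((\<lambda>s. P s t) has_vector_derivative t *\<^sub>R (w - z)) (at s within T)" for s t T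
    unfolding P_def Z_def by (auto intro!: derivative_eq_intros)
  have dPt: "(P s has_vector_derivative (Z s - y)) (at t within T)" for s t T
    unfolding P_def by (auto intro!: derivative_eq_intros)
  have lin: "linear (W' x)" if "x \<in> U" for x
    using W[OF that] by (rule has_derivative_linear)
  have dWs: "((\<lambda>s. W (P s t)) has_vector_derivative t *\<^sub>R W' (P s t) (w - z)) (at s within T)"
    if "s \<in> {0..1}" "t \<in> {0..1}" for s t T
    using vector_derivative_diff_chain_within[OF dPs has_derivative_at_withinI[OF W[OF PU[OF that]]]]
      linear_cmul[OF lin[OF PU[OF that]]] by (simp add: o_def)
  have dWt: "((\<lambda>t. W (P s t)) has_vector_derivative W' (P s t) (Z s - y)) (at t within T)"
    if "s \<in> {0..1}" "t \<in> {0..1}" for s t T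
    using vector_derivative_diff_chain_within[OF dPt has_derivative_at_withinI[OF W[OF PU[OF that]]]]
    by (simp add: o_def)
  have contP: "continuous_on T (\<lambda>x. P (f x) (g x))" if "continuous_on T f" "continuous_on T g"
    for T :: "'c::topological_space set" and f g
    unfolding P_def Z_def by (intro continuous_intros that)
  have contPW: "continuous_on T (\<lambda>x. W (P (f x) (g x)))"
    "continuous_on T (\<lambda>x. W' (P (f x) (g x)) v)"
    if "continuous_on T f" "continuous_on T g" "\<And>x. x \<in> T \<Longrightarrow> f x \<in> {0..1} \<and> g x \<in> {0..1}"
    for T :: "'c::topological_space set" and f g v
    using that by (auto intro!: continuous_on_compose2[OF contW contP] continuous_on_compose2[OF contW' contP] PU)
  have dF: "(F has_vector_derivative integral {0..1} (\<phi>' s)) (at s within {0..1})" if "s \<in> {0..1}" for s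
  proof -
    have "((\<lambda>s. integral (cbox 0 1) (\<phi> s)) has_vector_derivative integral (cbox 0 1) (\<phi>' s)) (at s within {0..1})"
    proof (rule leibniz_rule_vector_derivative)
      fix s t :: real assume st: "s \<in> {0..1}" "t \<in> cbox 0 1"
      then have "((\<lambda>s. \<phi> s t) has_vector_derivative
          W (P s t) \<bullet> (w - z) + (t *\<^sub>R W' (P s t) (w - z)) \<bullet> (Z s - y)) (at s within {0..1})"
        unfolding \<phi>_def
        by (intro bounded_bilinear.has_vector_derivative[OF bounded_bilinear_inner] dWs
            has_vector_derivative_diff_const[THEN iffD2] dZ) auto
      then show "((\<lambda>s. \<phi> s t) has_vector_derivative \<phi>' s t) (at s within {0..1})"
        unfolding \<phi>'_def by simp
    next
      fix s :: real assume "s \<in> {0..1}"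
      then show "\<phi> s integrable_on cbox 0 1"
        unfolding \<phi>_def
        by (intro integrable_continuous continuous_intros contPW) auto
    next
      show "continuous_on ({0..1} \<times> cbox 0 1) (\<lambda>(s, t). \<phi>' s t)"
        unfolding \<phi>'_def case_prod_unfold Z_def
        by (intro continuous_intros contPW) auto
    qed (use that in auto)
    then show ?thesis unfolding F_def by simp
  qed
  have int\<phi>': "integral {0..1} (\<phi>' s) = W (Z s) \<bullet> (w - z)" if "s \<in> {0..1}" for s
  proof -
    \<comment> \<open>By symmetry of \<open>W'\<close>, the integrand \<open>\<phi>' s\<close> is
      the derivative in \<open>t\<close> of \<open>t * (W (P s t) \<bullet> (w - z))\<close>. This
      vanishes at \<open>t = 0\<close>, and \<open>P s 1 = Z s\<close>.\<close>
    have "(\<phi>' s has_integral (1 * (W (P s 1) \<bullet> (w - z)) - 0 * (W (P s 0) \<bullet> (w - z)))) {0..1}"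
    proof (rule fundamental_theorem_of_calculus)
      fix t :: real assume t: "t \<in> {0..1}"
      have "((\<lambda>t. t * (W (P s t) \<bullet> (w - z))) has_vector_derivative
          t * (W' (P s t) (Z s - y) \<bullet> (w - z)) + 1 * (W (P s t) \<bullet> (w - z))) (at t within {0..1})"
        by (intro bounded_bilinear.has_vector_derivative[OF bounded_bilinear_mult]
            bounded_linear.has_vector_derivative[OF bounded_linear_inner_left] dWt[OF that t]
            has_vector_derivative_id)
      then show "((\<lambda>t. t * (W (P s t) \<bullet> (w - z))) has_vector_derivative \<phi>' s t) (at t within {0..1})"
        unfolding \<phi>'_def using sym[OF PU[OF that t]] by (simp add: add.commute)
    qed simp
    then show ?thesis unfolding P_def by (auto dest: integral_unique)
  qed
  have "((\<lambda>s. W (Z s) \<bullet> (w - z)) has_integral (F 1 - F 0)) {0..1}"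
    by (rule fundamental_theorem_of_calculus) (use dF int\<phi>' in auto)
  then have "integral {0..1} (\<lambda>s. W (Z s) \<bullet> (w - z)) = F 1 - F 0"
    by (rule integral_unique)
  then show "integral {0..1} (\<lambda>t. W (y + t *\<^sub>R (z - y)) \<bullet> (z - y)) +
      integral {0..1} (\<lambda>t. W (z + t *\<^sub>R (w - z)) \<bullet> (w - z)) =
      integral {0..1} (\<lambda>t. W (y + t *\<^sub>R (w - y)) \<bullet> (w - y))"
    unfolding F_def \<phi>_def P_def Z_def by simp
qed

text \<open>The error is the integral of
  \<open>(W (x + t *\<^sub>R (z - x)) - W x) \<bullet> (z - x)\<close>, which continuity at
  \<open>x\<close> bounds by \<open>e * norm (z - x)\<close>. The derivative is taken at the common
  starting point of the segments, so nothing is differentiated under the integral.\<close>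

lemma has_derivative_line_integral:
  fixes W :: "'a::euclidean_space \<Rightarrow> 'a"
  assumes r: "r > 0" and W: "continuous_on (ball x r) W"
  shows "((\<lambda>z. integral {0..1} (\<lambda>t. W (x + t *\<^sub>R (z - x)) \<bullet> (z - x))) has_derivative
          (\<lambda>v. W x \<bullet> v)) (at x)"
  unfolding has_derivative_at_alt
proof (intro conjI allI impI)
  show "bounded_linear ((\<bullet>) (W x))" by (rule bounded_linear_inner_right)
  fix e :: real assume e: "e > 0"
  have "isCont W x" using W r by (simp add: continuous_on_eq_continuous_at)
  then obtain \<delta> where \<delta>: "\<delta> > 0" "\<And>y. dist y x < \<delta> \<Longrightarrow> dist (W y) (W x) < e"
    using e unfolding continuous_at_eps_delta by metis
  have "\<bar>integral {0..1} (\<lambda>t. W (x + t *\<^sub>R (z - x)) \<bullet> (z - x)) - W x \<bullet> (z - x)\<bar> \<le> e * norm (z - x)"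
    if z: "norm (z - x) < min \<delta> r" for z
  proof -
    have near: "norm (t *\<^sub>R (z - x)) < min \<delta> r" if "t \<in> {0..1}" for t
    proof -
      have "norm (t *\<^sub>R (z - x)) \<le> 1 * norm (z - x)"
        unfolding norm_scaleR using that by (intro mult_right_mono) auto
      then show ?thesis using z by linarith
    qed
    have "continuous_on {0..1} (\<lambda>t. W (x + t *\<^sub>R (z - x)))"
      by (rule continuous_on_compose2[OF W]) (use near in \<open>auto intro!: continuous_intros simp: dist_norm\<close>)
    then have "((\<lambda>t. W (x + t *\<^sub>R (z - x)) \<bullet> (z - x)) has_integral
        integral {0..1} (\<lambda>t. W (x + t *\<^sub>R (z - x)) \<bullet> (z - x))) {0..1}"
      by (intro integrable_integral integrable_continuous_real continuous_intros)
    note int = has_integral_diff[OF this has_integral_const_real[of "W x \<bullet> (z - x)" 0 1]]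
    have "norm (integral {0..1} (\<lambda>t. W (x + t *\<^sub>R (z - x)) \<bullet> (z - x)) -
        measure lborel {0..1::real} *\<^sub>R (W x \<bullet> (z - x))) \<le> (e * norm (z - x)) * measure lborel {0..1::real}"
    proof (rule has_integral_bound_real[OF _ finite.emptyI int])
      fix t :: real assume "t \<in> {0..1} - {}"
      then have t: "t \<in> {0..1}" by simp
      have "\<bar>(W (x + t *\<^sub>R (z - x)) - W x) \<bullet> (z - x)\<bar> \<le> norm (W (x + t *\<^sub>R (z - x)) - W x) * norm (z - x)"
        by (rule Cauchy_Schwarz_ineq2)
      also have "\<dots> \<le> e * norm (z - x)"
        using near[OF t] less_imp_le[OF \<delta>(2)[of "x + t *\<^sub>R (z - x)"]]
        by (intro mult_right_mono) (auto simp: dist_norm)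
      finally show "norm (W (x + t *\<^sub>R (z - x)) \<bullet> (z - x) - W x \<bullet> (z - x)) \<le> e * norm (z - x)"
        by (simp add: inner_diff_left)
    qed (use e in auto)
    then show ?thesis by simp
  qed
  then show "\<exists>d>0. \<forall>y. norm (y - x) < d \<longrightarrow>
      norm (integral {0..1} (\<lambda>t. W (x + t *\<^sub>R (y - x)) \<bullet> (y - x)) -
        integral {0..1} (\<lambda>t. W (x + t *\<^sub>R (x - x)) \<bullet> (x - x)) - W x \<bullet> (y - x)) \<le> e * norm (y - x)"
    using \<delta>(1) r by (intro exI[of _ "min \<delta> r"]) auto
qed

text \<open>Every point serves as the centre of its own ball: near \<open>x\<close> the primitive
  equals \<open>u x + d x z\<close>, and this is differentiated at \<open>z = x\<close>
  only.\<close>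

lemma simply_connected_closed_form_exact:
  fixes W :: "'a::euclidean_space \<Rightarrow> 'a"
  assumes S: "open S" "simply_connected S"
    and W: "\<And>y. y \<in> S \<Longrightarrow> (W has_derivative W' y) (at y)"
    and contW': "\<And>v. continuous_on S (\<lambda>y. W' y v)"
    and sym: "\<And>y v w. y \<in> S \<Longrightarrow> W' y v \<bullet> w = W' y w \<bullet> v"
  obtains u where "\<And>y. y \<in> S \<Longrightarrow> (u has_derivative (\<lambda>v. W y \<bullet> v)) (at y)"
proof -
  define d where "d = (\<lambda>y z. integral {0..1} (\<lambda>t. W (y + t *\<^sub>R (z - y)) \<bullet> (z - y)))"
  have "\<exists>r>0. ball x r \<subseteq> S \<and> additive_within (ball x r) d" if x: "x \<in> S" for x
  proof -
    obtain r where r: "r > 0" "ball x r \<subseteq> S"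
      using S(1) x open_contains_ball by blast
    have "additive_within (ball x r) d"
      unfolding d_def
      by (rule additive_within_closed_form[where W' = W'])
         (use r(2) W sym continuous_on_subset[OF contW'] in auto)
    then show ?thesis using r by blast
  qed
  from simply_connected_additive_primitive[OF S(2) this]
  obtain u where u: "\<And>x. x \<in> S \<Longrightarrow> \<exists>r>0. \<forall>y\<in>ball x r. \<forall>z\<in>ball x r. u z = u y + d y z" by blast
  show ?thesis
  proof (rule that)
    fix x assume x: "x \<in> S"
    obtain r where r: "r > 0" "\<And>z. z \<in> ball x r \<Longrightarrow> u z = u x + d x z"
      using u[OF x] by (metis centre_in_ball)
    obtain r' where r': "r' > 0" "ball x r' \<subseteq> S"
      using S(1) x open_contains_ball by blast
    have "continuous_on (ball x r') W"
      using W r'(2) has_derivative_continuous by (blast intro: continuous_at_imp_continuous_on)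
    then have "(d x has_derivative (\<lambda>v. W x \<bullet> v)) (at x)"
      unfolding d_def by (rule has_derivative_line_integral[OF r'(1)])
    from has_derivative_add[OF has_derivative_const this, of "u x"]
    have "((\<lambda>z. u x + d x z) has_derivative (\<lambda>v. W x \<bullet> v)) (at x)" by simp
    then show "(u has_derivative (\<lambda>v. W x \<bullet> v)) (at x)"
      by (rule has_derivative_transform_within_open[where s = "ball x r"]) (simp_all add: r(1) flip: r(2))
  qed
qed

section \<open>Weak derivatives of curves\<close>

text \<open>
  The test functions for the weak derivative are differences of rescaled copies of \<open>step\<close>, a
  continuously differentiable spline with derivative \<open>hat\<close>; they converge to indicators of
  intervals.
\<close>

definition hat :: "real \<Rightarrow> real" where
  "hat x = max 0 x - 2 * max 0 (x - 1) + max 0 (x - 2)"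

definition step :: "real \<Rightarrow> real" where
  "step x = ((max 0 x)\<^sup>2 - 2 * (max 0 (x - 1))\<^sup>2 + (max 0 (x - 2))\<^sup>2) / 2"

lemma hat_nonneg: "hat x \<ge> 0"
  and hat_eq_0: "x \<le> 0 \<or> x \<ge> 2 \<Longrightarrow> hat x = 0"
  unfolding hat_def by (auto simp: max_def)

lemma continuous_on_hat: "continuous_on S hat"
  unfolding hat_def by (intro continuous_intros)

lemma step_eq_0: "x \<le> 0 \<Longrightarrow> step x = 0"
  and step_eq_1: "x \<ge> 2 \<Longrightarrow> step x = 1"
  unfolding step_def by (auto simp: max_def power2_eq_square algebra_simps)

lemma DERIV_positive_part_squared: "((\<lambda>x::real. (max 0 x)\<^sup>2) has_real_derivative 2 * max 0 x) (at x)"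
  unfolding has_field_derivative_def has_derivative_at_alt
proof (intro conjI allI impI)
  show "bounded_linear ((*) (2 * max 0 x))" by (rule bounded_linear_mult_right)
  fix e :: real assume "e > 0"
  have "\<bar>(max 0 y)\<^sup>2 - (max 0 x)\<^sup>2 - 2 * max 0 x * (y - x)\<bar> \<le> e * \<bar>y - x\<bar>" if "\<bar>y - x\<bar> < e" for y
  proof -
    \<comment> \<open>When \<open>x\<close> and \<open>y\<close> have different signs,
      \<open>x * y \<le> 0\<close> makes \<open>(y - x)\<^sup>2\<close> dominate both
      \<open>x * x - 2 * (x * y)\<close> and \<open>y * y\<close>, the remainders in the two mixed
      cases.\<close>
    have "\<bar>(max 0 y)\<^sup>2 - (max 0 x)\<^sup>2 - 2 * max 0 x * (y - x)\<bar> \<le> (y - x)\<^sup>2"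
    proof (cases "x \<ge> 0"; cases "y \<ge> 0")
      assume xy: "x \<ge> 0" "\<not> y \<ge> 0"
      then have "(max 0 y)\<^sup>2 - (max 0 x)\<^sup>2 - 2 * max 0 x * (y - x) = x * x - 2 * (x * y)"
        by (simp add: max_def power2_eq_square algebra_simps)
      moreover have "x * y \<le> 0" using xy by (simp add: mult_nonneg_nonpos)
      moreover have "(y - x)\<^sup>2 = x * x - 2 * (x * y) + y * y"
        by (simp add: power2_eq_square algebra_simps)
      ultimately show ?thesis using zero_le_square[of x] zero_le_square[of y] by linarith
    next
      assume xy: "\<not> x \<ge> 0" "y \<ge> 0"
      then have "(max 0 y)\<^sup>2 - (max 0 x)\<^sup>2 - 2 * max 0 x * (y - x) = y * y"
        by (simp add: max_def power2_eq_square)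
      moreover have "x * y \<le> 0" using xy by (simp add: mult_nonpos_nonneg)
      moreover have "(y - x)\<^sup>2 = x * x - 2 * (x * y) + y * y"
        by (simp add: power2_eq_square algebra_simps)
      ultimately show ?thesis using zero_le_square[of x] zero_le_square[of y] by linarith
    next
      assume "x \<ge> 0" "y \<ge> 0"
      then have "(max 0 y)\<^sup>2 - (max 0 x)\<^sup>2 - 2 * max 0 x * (y - x) = (y - x)\<^sup>2"
        by (simp add: max_def power2_eq_square algebra_simps)
      then show ?thesis by simp
    qed (simp add: max_def)
    also have "\<dots> = \<bar>y - x\<bar> * \<bar>y - x\<bar>" by (simp add: power2_eq_square)
    also have "\<dots> \<le> e * \<bar>y - x\<bar>" using that by (intro mult_right_mono) auto
    finally show ?thesis .
  qed
  then show "\<exists>d>0. \<forall>y. norm (y - x) < d \<longrightarrow>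
      norm ((max 0 y)\<^sup>2 - (max 0 x)\<^sup>2 - 2 * max 0 x * (y - x)) \<le> e * norm (y - x)"
    using \<open>e > 0\<close> by (intro exI[of _ e]) auto
qed

lemma DERIV_step: "(step has_real_derivative hat x) (at x)"
proof -
  have shift: "((\<lambda>x. (max 0 (x - a))\<^sup>2) has_real_derivative 2 * max 0 (x - a)) (at x)" for a :: real
  proof -
    have "((\<lambda>x. x - a) has_real_derivative 1) (at x)" by (auto intro!: derivative_eq_intros)
    from DERIV_chain2[OF DERIV_positive_part_squared this] show ?thesis by simp
  qed
  have "((\<lambda>x. ((max 0 x)\<^sup>2 - 2 * (max 0 (x - 1))\<^sup>2 + (max 0 (x - 2))\<^sup>2) / 2) has_real_derivative
      (2 * max 0 x - 2 * (2 * max 0 (x - 1)) + 2 * max 0 (x - 2)) / 2) (at x)"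
    by (intro DERIV_cdivide DERIV_add DERIV_diff DERIV_cmult DERIV_positive_part_squared shift)
  moreover have "(2 * max 0 x - 2 * (2 * max 0 (x - 1)) + 2 * max 0 (x - 2)) / 2 = hat x"
    unfolding hat_def by (simp add: diff_divide_distrib add_divide_distrib)
  ultimately show ?thesis unfolding step_def[abs_def] by simp
qed

lemma step_bounds: "0 \<le> step x" "step x \<le> 1"
proof -
  have mono: "step x \<le> step y" if "x \<le> y" for x y
    by (rule DERIV_nonneg_imp_nondecreasing[OF that]) (use DERIV_step hat_nonneg in blast)
  show "0 \<le> step x" using mono[of "min x 0" x] step_eq_0[of "min x 0"] by simp
  show "step x \<le> 1" using mono[of x "max x 2"] step_eq_1[of "max x 2"] by simp
qed

lemma DERIV_step_scaled:
  assumes "\<delta> > 0"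
  shows "((\<lambda>\<tau>. step ((\<tau> - s) / \<delta>)) has_real_derivative hat ((\<tau> - s) / \<delta>) / \<delta>) (at \<tau> within T)"
proof -
  have "((\<lambda>\<tau>. (\<tau> - s) / \<delta>) has_real_derivative 1 / \<delta>) (at \<tau> within T)"
    using assms by (auto intro!: derivative_eq_intros)
  from DERIV_chain2[OF DERIV_step this] show ?thesis by simp
qed

lemma hat_approximate_identity:
  fixes c :: "real \<Rightarrow> 'a::euclidean_space"
  assumes c: "continuous_on {0..1} c" and s: "0 \<le> s" "s < 1"
  shows "((\<lambda>\<delta>. LINT \<tau>|lebesgue_on {0..1}. (hat ((\<tau> - s) / \<delta>) / \<delta>) *\<^sub>R c \<tau>) \<longlongrightarrow> c s) (at_right 0)"
proof (rule tendstoI)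
  fix e :: real assume e: "e > 0"
  obtain d where d: "d > 0" "\<And>\<tau>. \<tau> \<in> {0..1} \<Longrightarrow> dist \<tau> s < d \<Longrightarrow> dist (c \<tau>) (c s) < e / 2"
    using c[unfolded continuous_on_iff] e s by (metis atLeastAtMost_iff half_gt_zero less_imp_le)
  have "dist (LINT \<tau>|lebesgue_on {0..1}. (hat ((\<tau> - s) / \<delta>) / \<delta>) *\<^sub>R c \<tau>) (c s) < e"
    if \<delta>: "0 < \<delta>" "\<delta> < min d (1 - s) / 2" for \<delta>
  proof -
    define \<rho> where "\<rho> = (\<lambda>\<tau>. hat ((\<tau> - s) / \<delta>) / \<delta>)"
    have cont\<rho>: "continuous_on {0..1} \<rho>"
      unfolding \<rho>_def using \<delta>(1)
      by (intro continuous_intros continuous_on_compose2[OF continuous_on_hat[of UNIV]]) auto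
    have "(\<rho> has_integral (step ((1 - s) / \<delta>) - step ((0 - s) / \<delta>))) {0..1}"
      unfolding \<rho>_def
      by (rule fundamental_theorem_of_calculus)
         (auto intro!: DERIV_step_scaled \<delta>(1) simp flip: has_real_derivative_iff_has_vector_derivative)
    moreover have "step ((1 - s) / \<delta>) = 1" "step ((0 - s) / \<delta>) = 0"
      using \<delta> s by (auto intro!: step_eq_1 step_eq_0 simp: field_simps)
    ultimately have int\<rho>: "(\<rho> has_integral 1) {0..1}" by simp
    have cont: "continuous_on {0..1} (\<lambda>\<tau>. \<rho> \<tau> *\<^sub>R c \<tau>)" by (intro continuous_intros cont\<rho> c)
    have "((\<lambda>\<tau>. \<rho> \<tau> *\<^sub>R c \<tau> - \<rho> \<tau> *\<^sub>R c s) has_integral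
        (integral {0..1} (\<lambda>\<tau>. \<rho> \<tau> *\<^sub>R c \<tau>) - 1 *\<^sub>R c s)) {0..1}"
      by (intro has_integral_diff integrable_integral integrable_continuous_real cont
          has_integral_scaleR_left int\<rho>)
    moreover have "((\<lambda>\<tau>. \<rho> \<tau> * (e / 2)) has_integral 1 * (e / 2)) {0..1}"
      by (intro has_integral_mult_left int\<rho>)
    moreover have "norm (\<rho> \<tau> *\<^sub>R c \<tau> - \<rho> \<tau> *\<^sub>R c s) \<le> \<rho> \<tau> * (e / 2)" if \<tau>: "\<tau> \<in> {0..1}" for \<tau>
    proof (cases "dist \<tau> s < d")
      case True
      have "norm (\<rho> \<tau> *\<^sub>R c \<tau> - \<rho> \<tau> *\<^sub>R c s) = \<rho> \<tau> * dist (c \<tau>) (c s)"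
        unfolding \<rho>_def scaleR_diff_right[symmetric] dist_norm using \<delta>(1) by (simp add: hat_nonneg)
      also have "\<dots> \<le> \<rho> \<tau> * (e / 2)"
        using d(2)[OF \<tau> True] \<delta>(1) hat_nonneg by (intro mult_left_mono) (auto simp: \<rho>_def)
      finally show ?thesis .
    next
      case False
      then have "(\<tau> - s) / \<delta> \<le> 0 \<or> (\<tau> - s) / \<delta> \<ge> 2"
        using \<delta> by (auto simp: dist_real_def field_simps abs_if split: if_splits)
      then have "\<rho> \<tau> = 0" unfolding \<rho>_def by (simp add: hat_eq_0)
      then show ?thesis by simp
    qed
    ultimately have "norm (integral {0..1} (\<lambda>\<tau>. \<rho> \<tau> *\<^sub>R c \<tau>) - 1 *\<^sub>R c s) \<le> 1 * (e / 2)"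
      using integral_norm_bound_integral[of "\<lambda>\<tau>. \<rho> \<tau> *\<^sub>R c \<tau> - \<rho> \<tau> *\<^sub>R c s" "{0..1}" "\<lambda>\<tau>. \<rho> \<tau> * (e / 2)"]
      by (simp only: has_integral_iff)
    moreover have "(LINT \<tau>|lebesgue_on {0..1}. (hat ((\<tau> - s) / \<delta>) / \<delta>) *\<^sub>R c \<tau>) =
        integral {0..1} (\<lambda>\<tau>. \<rho> \<tau> *\<^sub>R c \<tau>)"
      using lebesgue_integral_eq_integral[OF continuous_imp_integrable_real[OF cont]] unfolding \<rho>_def by simp
    ultimately show ?thesis
      unfolding dist_norm using e by simp
  qed
  then show "\<forall>\<^sub>F \<delta> in at_right 0.
      dist (LINT \<tau>|lebesgue_on {0..1}. (hat ((\<tau> - s) / \<delta>) / \<delta>) *\<^sub>R c \<tau>) (c s) < e"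
    unfolding eventually_at_right_field using d(1) s(2)
    by (intro exI[of _ "min d (1 - s) / 2"]) auto
qed

text \<open>The interval has finite measure, and \<open>2 * r \<le> 1 + r\<^sup>2\<close>.\<close>

lemma L2_unit_interval_integrable:
  assumes "L2_unit_interval v"
  shows "integrable (lebesgue_on {0..1}) v"
proof (rule Bochner_Integration.integrable_bound)
  show "integrable (lebesgue_on {0..1}) (\<lambda>t. 1 + (norm (v t))\<^sup>2)"
    using assms unfolding L2_unit_interval_def by (intro Bochner_Integration.integrable_add) auto
  have "norm (v t) \<le> norm (1 + (norm (v t))\<^sup>2)" for t
  proof -
    have "2 * norm (v t) \<le> 1 + (norm (v t))\<^sup>2"
      using sum_squares_bound[of "norm (v t)" 1] by (simp add: add.commute)
    then show ?thesis using norm_ge_zero[of "v t"] unfolding real_norm_def by linarith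
  qed
  then show "AE t in lebesgue_on {0..1}. norm (v t) \<le> norm (1 + (norm (v t))\<^sup>2)" by simp
qed (use assms in \<open>simp add: L2_unit_interval_def\<close>)

text \<open>The test function \<open>\<phi> \<delta>\<close> rises just after \<open>s\<close> and
  falls just after \<open>t\<close>. Its derivative is a difference of two approximate identities,
  so one side of the weak identity tends to \<open>c s - c t\<close>, while
  \<open>\<phi> \<delta>\<close> itself tends to the indicator of an interval. Strict inequalities
  leave room for its support inside the open unit interval.\<close>

lemma W12_weak_derivative_interior:
  assumes w: "W12_weak_derivative c v" and c: "continuous_on {0..1} c"
    and st: "0 < s" "s < t" "t < 1"
  shows "c t - c s = integral {s..t} v"
proof -
  have v: "integrable (lebesgue_on {0..1}) v"
    using w L2_unit_interval_integrable unfolding W12_weak_derivative_def by blast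
  define \<phi> where "\<phi> = (\<lambda>\<delta> \<tau>. step ((\<tau> - s) / \<delta>) - step ((\<tau> - t) / \<delta>))"
  define \<phi>' where "\<phi>' = (\<lambda>\<delta> \<tau>. hat ((\<tau> - s) / \<delta>) / \<delta> - hat ((\<tau> - t) / \<delta>) / \<delta>)"
  have d\<phi>: "(\<phi> \<delta> has_real_derivative \<phi>' \<delta> \<tau>) (at \<tau>)" if "\<delta> > 0" for \<delta> \<tau>
    unfolding \<phi>_def \<phi>'_def by (intro DERIV_diff DERIV_step_scaled that)
  have cont_hat: "continuous_on S (\<lambda>\<tau>. hat ((\<tau> - r) / \<delta>) / \<delta>)" if "\<delta> > 0" for r \<delta> S
    using that by (intro continuous_intros continuous_on_compose2[OF continuous_on_hat[of UNIV]]) auto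
  have weak: "(LINT \<tau>|lebesgue_on {0..1}. (hat ((\<tau> - s) / \<delta>) / \<delta>) *\<^sub>R c \<tau>) -
      (LINT \<tau>|lebesgue_on {0..1}. (hat ((\<tau> - t) / \<delta>) / \<delta>) *\<^sub>R c \<tau>) =
      - (LINT \<tau>|lebesgue_on {0..1}. \<phi> \<delta> \<tau> *\<^sub>R v \<tau>)" if \<delta>: "0 < \<delta>" "\<delta> < (1 - t) / 2" for \<delta>
  proof -
    have supp: "closure {\<tau>. \<phi> \<delta> \<tau> \<noteq> 0} \<subseteq> {s..t + 2 * \<delta>}"
    proof (rule closure_minimal)
      have "\<phi> \<delta> \<tau> = 0" if "\<tau> \<notin> {s..t + 2 * \<delta>}" for \<tau>
      proof (cases "\<tau> < s")
        case True
        then show ?thesis unfolding \<phi>_def using \<delta> st by (simp add: step_eq_0 field_simps)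
      next
        case False
        then have "\<tau> > t + 2 * \<delta>" using that by auto
        then show ?thesis unfolding \<phi>_def using \<delta> st by (simp add: step_eq_1 field_simps)
      qed
      then show "{\<tau>. \<phi> \<delta> \<tau> \<noteq> 0} \<subseteq> {s..t + 2 * \<delta>}" by blast
    qed simp
    have "bounded (closure {\<tau>. \<phi> \<delta> \<tau> \<noteq> 0})"
      by (rule bounded_subset[OF _ supp]) simp
    then have "compact (closure {\<tau>. \<phi> \<delta> \<tau> \<noteq> 0})"
      by (simp add: compact_eq_bounded_closed)
    moreover have "closure {\<tau>. \<phi> \<delta> \<tau> \<noteq> 0} \<subseteq> {0<..<1}"
      using supp st \<delta> by (auto simp: field_simps)
    moreover have "\<phi> \<delta> C1_differentiable_on UNIV"
      unfolding C1_differentiable_on_def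
      by (intro exI[of _ "\<phi>' \<delta>"])
         (use d\<phi>[OF \<delta>(1)] cont_hat[OF \<delta>(1)] in
           \<open>auto simp: \<phi>'_def intro!: continuous_on_diff simp flip: has_real_derivative_iff_has_vector_derivative\<close>)
    ultimately have "(LINT \<tau>|lebesgue_on {0..1}. deriv (\<phi> \<delta>) \<tau> *\<^sub>R c \<tau>) =
        - (LINT \<tau>|lebesgue_on {0..1}. \<phi> \<delta> \<tau> *\<^sub>R v \<tau>)"
      using w unfolding W12_weak_derivative_def by blast
    moreover have "deriv (\<phi> \<delta>) = \<phi>' \<delta>"
      using DERIV_imp_deriv[OF d\<phi>[OF \<delta>(1)]] by blast
    moreover have "(LINT \<tau>|lebesgue_on {0..1}. \<phi>' \<delta> \<tau> *\<^sub>R c \<tau>) =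
        (LINT \<tau>|lebesgue_on {0..1}. (hat ((\<tau> - s) / \<delta>) / \<delta>) *\<^sub>R c \<tau>) -
        (LINT \<tau>|lebesgue_on {0..1}. (hat ((\<tau> - t) / \<delta>) / \<delta>) *\<^sub>R c \<tau>)"
      unfolding \<phi>'_def scaleR_diff_left
      by (intro Bochner_Integration.integral_diff continuous_imp_integrable_real continuous_on_scaleR
          cont_hat \<delta> c)
    ultimately show ?thesis by simp
  qed
  \<comment> \<open>A sequence of scales, because dominated convergence is applied along sequences;
    the bound \<open>\<bar>\<phi>\<bar> \<le> 1\<close> makes \<open>norm (v \<tau>)\<close> a
    dominating function.\<close>
  define \<delta> where "\<delta> = (\<lambda>n. inverse (real (Suc n)))"
  have \<delta>_pos: "\<delta> n > 0" for n unfolding \<delta>_def by simp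
  have \<delta>_0: "\<delta> \<longlonglongrightarrow> 0" unfolding \<delta>_def by (rule LIMSEQ_inverse_real_of_nat)
  have \<delta>_right: "filterlim \<delta> (at_right 0) sequentially"
    using \<delta>_0 \<delta>_pos by (intro tendsto_imp_filterlim_at_right) auto
  have lim_v: "(\<lambda>n. LINT \<tau>|lebesgue_on {0..1}. \<phi> (\<delta> n) \<tau> *\<^sub>R v \<tau>) \<longlonglongrightarrow>
      (LINT \<tau>|lebesgue_on {0..1}. indicator {s<..t} \<tau> *\<^sub>R v \<tau>)"
  proof (rule integral_dominated_convergence[where w = "\<lambda>\<tau>. norm (v \<tau>)"])
    show "(\<lambda>\<tau>. indicator {s<..t} \<tau> *\<^sub>R v \<tau>) \<in> borel_measurable (lebesgue_on {0..1})"
    proof (intro borel_measurable_scaleR borel_measurable_integrable[OF v])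
      have "{s<..t} \<subseteq> {0..1}" using st by auto
      then show "indicat_real {s<..t} \<in> borel_measurable (lebesgue_on {0..1})"
        by (simp add: Int_absorb2 borel_measurable_indicator_iff sets_restrict_space_iff)
    qed
    show "(\<lambda>\<tau>. \<phi> (\<delta> n) \<tau> *\<^sub>R v \<tau>) \<in> borel_measurable (lebesgue_on {0..1})" for n
    proof (intro borel_measurable_scaleR borel_measurable_integrable[OF v])
      have "continuous_on {0..1} (\<phi> (\<delta> n))"
        by (rule DERIV_continuous_on[OF has_field_derivative_at_within[OF d\<phi>[OF \<delta>_pos]]])
      then show "\<phi> (\<delta> n) \<in> borel_measurable (lebesgue_on {0..1})"
        by (intro continuous_imp_measurable_on_sets_lebesgue) auto
    qed
    \<comment> \<open>Since \<open>step 0 = 0\<close>, the limit at \<open>\<tau> = r\<close> is 0.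
      This is why the limiting indicator belongs to the interval open at \<open>s\<close> and closed
      at \<open>t\<close>.\<close>
    have lim_step: "(\<lambda>n. step ((\<tau> - r) / \<delta> n)) \<longlonglongrightarrow> (if \<tau> > r then 1 else 0)" for r \<tau>
    proof (cases "\<tau> > r")
      case True
      have "\<forall>\<^sub>F n in sequentially. \<delta> n < (\<tau> - r) / 2"
        using \<delta>_0 True by (intro order_tendstoD(2)) auto
      then have "\<forall>\<^sub>F n in sequentially. step ((\<tau> - r) / \<delta> n) = 1"
        by eventually_elim (use \<delta>_pos in \<open>simp add: step_eq_1 field_simps\<close>)
      then show ?thesis using True by (simp add: tendsto_eventually)
    next
      case False
      then have "step ((\<tau> - r) / \<delta> n) = 0" for n
        using \<delta>_pos[of n] by (intro step_eq_0) (simp add: divide_le_0_iff)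
      then show ?thesis using False by simp
    qed
    have "(\<lambda>n. \<phi> (\<delta> n) \<tau> *\<^sub>R v \<tau>) \<longlonglongrightarrow> indicator {s<..t} \<tau> *\<^sub>R v \<tau>" for \<tau>
    proof -
      have "(if \<tau> > s then 1 else 0) - (if \<tau> > t then 1 else 0) = (indicator {s<..t} \<tau> :: real)"
        using st by auto
      then show ?thesis
        unfolding \<phi>_def using tendsto_diff[OF lim_step[of \<tau> s] lim_step[of \<tau> t]]
        by (intro tendsto_scaleR tendsto_const) simp
    qed
    then show "AE \<tau> in lebesgue_on {0..1}. (\<lambda>n. \<phi> (\<delta> n) \<tau> *\<^sub>R v \<tau>) \<longlonglongrightarrow> indicator {s<..t} \<tau> *\<^sub>R v \<tau>"
      by simp
    have "\<bar>\<phi> (\<delta> n) \<tau>\<bar> \<le> 1" for n \<tau>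
      unfolding \<phi>_def using step_bounds[of "(\<tau> - s) / \<delta> n"] step_bounds[of "(\<tau> - t) / \<delta> n"] by linarith
    then show "AE \<tau> in lebesgue_on {0..1}. norm (\<phi> (\<delta> n) \<tau> *\<^sub>R v \<tau>) \<le> norm (v \<tau>)" for n
      by (simp add: mult_left_le_one_le)
  qed (use v in auto)
  have "\<forall>\<^sub>F n in sequentially. \<delta> n < (1 - t) / 2"
    using \<delta>_0 st by (intro order_tendstoD(2)) auto
  then have ev: "\<forall>\<^sub>F n in sequentially. (LINT \<tau>|lebesgue_on {0..1}. (hat ((\<tau> - s) / \<delta> n) / \<delta> n) *\<^sub>R c \<tau>) -
      (LINT \<tau>|lebesgue_on {0..1}. (hat ((\<tau> - t) / \<delta> n) / \<delta> n) *\<^sub>R c \<tau>) =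
      - (LINT \<tau>|lebesgue_on {0..1}. \<phi> (\<delta> n) \<tau> *\<^sub>R v \<tau>)"
    by eventually_elim (rule weak[OF \<delta>_pos])
  have "(\<lambda>n. (LINT \<tau>|lebesgue_on {0..1}. (hat ((\<tau> - s) / \<delta> n) / \<delta> n) *\<^sub>R c \<tau>) -
      (LINT \<tau>|lebesgue_on {0..1}. (hat ((\<tau> - t) / \<delta> n) / \<delta> n) *\<^sub>R c \<tau>)) \<longlonglongrightarrow> c s - c t"
    using st by (intro tendsto_diff filterlim_compose[OF hat_approximate_identity[OF c] \<delta>_right]) auto
  moreover have "(\<lambda>n. (LINT \<tau>|lebesgue_on {0..1}. (hat ((\<tau> - s) / \<delta> n) / \<delta> n) *\<^sub>R c \<tau>) -
      (LINT \<tau>|lebesgue_on {0..1}. (hat ((\<tau> - t) / \<delta> n) / \<delta> n) *\<^sub>R c \<tau>)) \<longlonglongrightarrow>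
      - (LINT \<tau>|lebesgue_on {0..1}. indicator {s<..t} \<tau> *\<^sub>R v \<tau>)"
    using tendsto_cong[THEN iffD2, OF ev tendsto_minus[OF lim_v]] .
  ultimately have "c s - c t = - (LINT \<tau>|lebesgue_on {0..1}. indicator {s<..t} \<tau> *\<^sub>R v \<tau>)"
    using LIMSEQ_unique by blast
  moreover have "(LINT \<tau>|lebesgue_on {0..1}. indicator {s<..t} \<tau> *\<^sub>R v \<tau>) = integral {s..t} v"
  proof -
    have "(LINT \<tau>|lebesgue_on {0..1}. indicator {s<..t} \<tau> *\<^sub>R v \<tau>) =
        (LINT \<tau>|lebesgue_on {0..1}. (if \<tau> \<in> {s<..t} then v \<tau> else 0))"
      by (intro Bochner_Integration.integral_cong) auto
    also have "\<dots> = (LINT \<tau>|lebesgue_on ({s<..t} \<inter> {0..1}). v \<tau>)"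
      by (rule Lebesgue_Measure.integral_restrict_Int) auto
    also have "{s<..t} \<inter> {0..1} = {s<..t}" using st by auto
    also have "(LINT \<tau>|lebesgue_on {s<..t}. v \<tau>) = integral {s<..t} v"
    proof (rule lebesgue_integral_eq_integral)
      have "integrable lebesgue (\<lambda>\<tau>. if \<tau> \<in> {0..1} then v \<tau> else 0)"
        using v by (subst Lebesgue_Measure.integrable_restrict_UNIV) auto
      then have "integrable lebesgue (\<lambda>\<tau>. indicator {s<..t} \<tau> *\<^sub>R (if \<tau> \<in> {0..1} then v \<tau> else 0))"
        by (intro integrable_mult_indicator) auto
      also have "(\<lambda>\<tau>. indicator {s<..t} \<tau> *\<^sub>R (if \<tau> \<in> {0..1} then v \<tau> else 0)) =
          (\<lambda>\<tau>. if \<tau> \<in> {s<..t} then v \<tau> else 0)" using st by (auto simp: fun_eq_iff)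
      finally show "integrable (lebesgue_on {s<..t}) v"
        by (subst (asm) Lebesgue_Measure.integrable_restrict_UNIV) auto
    qed simp
    also have "\<dots> = integral {s..t} v"
      by (rule integral_spike_set) (auto intro: negligible_subset[of "{s}"])
    finally show ?thesis .
  qed
  ultimately show ?thesis by (simp add: algebra_simps)
qed

text \<open>The difference \<open>e\<close> between \<open>c\<close> and the indefinite integral of
  \<open>v\<close> is constant on the open interval by the interior case, and it is continuous up to
  the end points.\<close>

lemma W12_weak_derivative_integral:
  assumes w: "W12_weak_derivative c v" and c: "continuous_on {0..1} c"
    and st: "0 \<le> s" "s \<le> t" "t \<le> 1"
  shows "c t - c s = integral {s..t} v"
proof -
  have "integrable (lebesgue_on {0..1}) v"
    using w L2_unit_interval_integrable unfolding W12_weak_derivative_def by blast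
  then have int: "v integrable_on {0..1}"
    by (rule integrable_on_lebesgue_on) simp
  define e where "e = (\<lambda>\<tau>. c \<tau> - integral {0..\<tau>} v)"
  have comb: "integral {0..s} v + integral {s..t} v = integral {0..t} v"
    if "0 \<le> s" "s \<le> t" "t \<le> 1" for s t
    using that integrable_subinterval_real[OF int, of 0 t]
    by (intro Henstock_Kurzweil_Integration.integral_combine) auto
  have conte: "continuous_on {0..1} e"
    unfolding e_def by (intro continuous_on_diff c indefinite_integral_continuous_1 int)
  have inner: "e \<tau> = e (1/2)" if "\<tau> \<in> {0<..<1}" for \<tau>
  proof -
    have const: "e \<tau>' = e \<tau>" if "0 < \<tau>" "\<tau> < \<tau>'" "\<tau>' < 1" for \<tau> \<tau>'
      using W12_weak_derivative_interior[OF w c that] comb[of \<tau> \<tau>'] that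
      unfolding e_def by (simp add: algebra_simps)
    show ?thesis
    proof (cases \<tau> "1/2 :: real" rule: linorder_cases)
      case less
      then show ?thesis using const[of \<tau> "1/2"] that by simp
    next
      case greater
      then show ?thesis using const[of "1/2" \<tau>] that by simp
    qed (simp only:)
  qed
  have "e \<tau> = e (1/2)" if "\<tau> \<in> {0..1}" for \<tau>
    by (rule continuous_constant_on_closure[of "{0<..<1}", OF _ inner]) (use conte that in simp_all)
  from this[of s] this[of t] have "e t = e s" using st by simp
  then have "c t - c s = integral {0..t} v - integral {0..s} v"
    unfolding e_def by (simp add: algebra_simps)
  also have "\<dots> = integral {s..t} v"
    unfolding comb[OF st, symmetric] by simp
  finally show ?thesis .
qed

text \<open>
  The error in the asserted identity is additive over adjacent intervals, so by bisection it
  suffices to bound it by a small multiple of the length of the curve on short intervals.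
\<close>

lemma integral_gradient_along_curve:
  fixes W :: "'a::euclidean_space \<Rightarrow> 'a" and c v :: "real \<Rightarrow> 'a"
  assumes S: "open S" and u: "\<And>y. y \<in> S \<Longrightarrow> (u has_derivative (\<lambda>h. W y \<bullet> h)) (at y)"
    and W: "continuous_on S W"
    and c: "continuous_on {0..1} c" "c ` {0..1} \<subseteq> S"
    and v: "integrable (lebesgue_on {0..1}) v"
    and cv: "\<And>s t. 0 \<le> s \<Longrightarrow> s \<le> t \<Longrightarrow> t \<le> 1 \<Longrightarrow> c t - c s = integral {s..t} v"
  shows "integrable (lebesgue_on {0..1}) (\<lambda>t. W (c t) \<bullet> v t)"
    and "u (c 1) - u (c 0) = (LINT t|lebesgue_on {0..1}. W (c t) \<bullet> v t)"
proof -
  have contWc: "continuous_on {0..1} (\<lambda>t. W (c t))"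
    by (rule continuous_on_compose2[OF W c])
  have av: "v absolutely_integrable_on {0..1}"
    by (subst absolutely_integrable_measurable) (use v in \<open>auto simp: o_def\<close>)
  have "(\<lambda>t. W (c t) \<bullet> v t) absolutely_integrable_on {0..1}"
    by (rule absolutely_integrable_bounded_measurable_product)
       (use av contWc in \<open>auto intro!: continuous_imp_measurable_on_sets_lebesgue
         compact_imp_bounded compact_continuous_image bilinear_conv_bounded_bilinear[THEN iffD2]
         bounded_bilinear_inner\<close>)
  then show int: "integrable (lebesgue_on {0..1}) (\<lambda>t. W (c t) \<bullet> v t)"
    by (rule absolutely_integrable_imp_integrable) simp
  have qint: "(\<lambda>t. W (c t) \<bullet> v t) integrable_on {a..b}" and vint: "v integrable_on {a..b}"
    and nint: "(\<lambda>t. norm (v t)) integrable_on {a..b}" if "0 \<le> a" "b \<le> 1" for a b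
  proof -
    have *: "{a..b} \<subseteq> {0..1}" using that by auto
    show "(\<lambda>t. W (c t) \<bullet> v t) integrable_on {a..b}"
      by (rule integrable_subinterval_real[OF integrable_on_lebesgue_on[OF int] *]) simp
    show "v integrable_on {a..b}" "(\<lambda>t. norm (v t)) integrable_on {a..b}"
      using absolutely_integrable_on_subinterval[OF av *] unfolding absolutely_integrable_on_def by auto
  qed
  define K where "K = integral {0..1} (\<lambda>t. norm (v t))"
  have bound: "\<bar>u (c 1) - u (c 0) - integral {0..1} (\<lambda>t. W (c t) \<bullet> v t)\<bar> \<le> 2 * e * K" if e: "e > 0" for e
  proof -
    \<comment> \<open>The range restrictions are premises inside \<open>P\<close>, because the
      bisection principle also tests intervals around a point that stick out of the unit
      interval.\<close>
    define P where "P = (\<lambda>a b. 0 \<le> a \<longrightarrow> a \<le> b \<longrightarrow> b \<le> 1 \<longrightarrow>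
      \<bar>u (c b) - u (c a) - integral {a..b} (\<lambda>t. W (c t) \<bullet> v t)\<bar> \<le> 2 * e * integral {a..b} (\<lambda>t. norm (v t)))"
    have "P 0 1"
    proof (rule Bolzano[where P = P])
      show "(0::real) \<le> 1" by simp
    next
      fix a b d assume *: "P a b" "P b d" "a \<le> b" "b \<le> d"
      show "P a d"
        unfolding P_def
      proof (intro impI)
        assume **: "0 \<le> a" "a \<le> d" "d \<le> 1"
        have 1: "integral {a..b} (\<lambda>t. W (c t) \<bullet> v t) + integral {b..d} (\<lambda>t. W (c t) \<bullet> v t) =
            integral {a..d} (\<lambda>t. W (c t) \<bullet> v t)"
          using * ** by (intro Henstock_Kurzweil_Integration.integral_combine qint) auto
        have 2: "2 * e * integral {a..b} (\<lambda>t. norm (v t)) + 2 * e * integral {b..d} (\<lambda>t. norm (v t)) =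
            2 * e * integral {a..d} (\<lambda>t. norm (v t))"
          unfolding distrib_left[symmetric] using * **
          by (intro arg_cong2[where f = "(*)"] Henstock_Kurzweil_Integration.integral_combine nint) auto
        have "\<bar>u (c b) - u (c a) - integral {a..b} (\<lambda>t. W (c t) \<bullet> v t)\<bar> \<le> 2 * e * integral {a..b} (\<lambda>t. norm (v t))"
          "\<bar>u (c d) - u (c b) - integral {b..d} (\<lambda>t. W (c t) \<bullet> v t)\<bar> \<le> 2 * e * integral {b..d} (\<lambda>t. norm (v t))"
          using * ** unfolding P_def by auto
        then show "\<bar>u (c d) - u (c a) - integral {a..d} (\<lambda>t. W (c t) \<bullet> v t)\<bar> \<le> 2 * e * integral {a..d} (\<lambda>t. norm (v t))"
          unfolding 1[symmetric] 2[symmetric] by linarith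
      qed
    next
      fix x :: real assume x: "0 \<le> x" "x \<le> 1"
      then have cx: "c x \<in> S" using c(2) by auto
      \<comment> \<open>The gradient is frozen at \<open>c x\<close>. Both the increment of
        \<open>u\<close> and the integral are compared with \<open>W0 \<bullet> (c b - c a)\<close>,
        each at the cost of \<open>e\<close> times the length; this is the factor 2 in
        \<open>P\<close>.\<close>
      define W0 where "W0 = W (c x)"
      obtain r1 where r1: "r1 > 0" "ball (c x) r1 \<subseteq> S" using S cx open_contains_ball by blast
      obtain r2 where r2: "r2 > 0" "\<And>y. y \<in> S \<Longrightarrow> dist y (c x) < r2 \<Longrightarrow> dist (W y) W0 < e"
        using W[unfolded continuous_on_iff] cx e unfolding W0_def by metis
      define r where "r = min r1 r2"
      have r: "r > 0" "ball (c x) r \<subseteq> S" "\<And>y. y \<in> ball (c x) r \<Longrightarrow> norm (W y - W0) \<le> e"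
        using r1 r2 unfolding r_def
        by (auto simp: dist_norm norm_minus_commute subset_iff intro!: less_imp_le)
      obtain d where d: "d > 0" "\<And>t. t \<in> {0..1} \<Longrightarrow> dist t x < d \<Longrightarrow> dist (c t) (c x) < r"
        using c(1)[unfolded continuous_on_iff] x r(1) by (metis atLeastAtMost_iff)
      have "P a b" if ab: "a \<le> x" "x \<le> b" "b - a < d" for a b
        unfolding P_def
      proof (intro impI)
        assume ab': "0 \<le> a" "a \<le> b" "b \<le> 1"
        have near: "c t \<in> ball (c x) r" if "t \<in> {a..b}" for t
          using d(2)[of t] that ab ab' by (auto simp: dist_commute dist_real_def)
        have "norm ((\<lambda>y. u y - W0 \<bullet> y) (c b) - (\<lambda>y. u y - W0 \<bullet> y) (c a)) \<le> e * norm (c b - c a)"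
        proof (rule differentiable_bound[where f' = "\<lambda>y h. W y \<bullet> h - W0 \<bullet> h"])
          fix y assume y: "y \<in> ball (c x) r"
          show "((\<lambda>y. u y - W0 \<bullet> y) has_derivative (\<lambda>h. W y \<bullet> h - W0 \<bullet> h)) (at y within ball (c x) r)"
            using y r(2) by (intro has_derivative_diff has_derivative_at_withinI[OF u]
                bounded_linear_imp_has_derivative bounded_linear_inner_right) auto
          show "onorm (\<lambda>h. W y \<bullet> h - W0 \<bullet> h) \<le> e"
          proof (rule onorm_bound)
            fix h
            have "norm (W y \<bullet> h - W0 \<bullet> h) \<le> norm (W y - W0) * norm h"
              unfolding inner_diff_left[symmetric] real_norm_def by (rule Cauchy_Schwarz_ineq2)
            also have "\<dots> \<le> e * norm h" using r(3)[OF y] by (intro mult_right_mono) auto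
            finally show "norm (W y \<bullet> h - W0 \<bullet> h) \<le> e * norm h" .
          qed (use e in simp)
        qed (use near ab' in auto)
        also have "c b - c a = integral {a..b} v" using cv ab' by simp
        also have "e * norm (integral {a..b} v) \<le> e * integral {a..b} (\<lambda>t. norm (v t))"
          using e ab' by (intro mult_left_mono Henstock_Kurzweil_Integration.integral_norm_bound_integral vint nint) auto
        finally have 1: "\<bar>u (c b) - u (c a) - W0 \<bullet> (c b - c a)\<bar> \<le> e * integral {a..b} (\<lambda>t. norm (v t))"
          by (simp add: inner_diff_right algebra_simps)
        have "((\<lambda>t. W0 \<bullet> v t) has_integral W0 \<bullet> integral {a..b} v) {a..b}"
          using has_integral_linear[OF integrable_integral[OF vint] bounded_linear_inner_right] ab'
          by (simp add: o_def)
        with integrable_integral[OF qint]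
        have "((\<lambda>t. W (c t) \<bullet> v t - W0 \<bullet> v t) has_integral
            integral {a..b} (\<lambda>t. W (c t) \<bullet> v t) - W0 \<bullet> integral {a..b} v) {a..b}"
          using ab' by (intro has_integral_diff) auto
        moreover have "norm (W (c t) \<bullet> v t - W0 \<bullet> v t) \<le> e * norm (v t)" if t: "t \<in> {a..b}" for t
        proof -
          have "norm (W (c t) \<bullet> v t - W0 \<bullet> v t) \<le> norm (W (c t) - W0) * norm (v t)"
            unfolding inner_diff_left[symmetric] real_norm_def by (rule Cauchy_Schwarz_ineq2)
          also have "\<dots> \<le> e * norm (v t)" using r(3)[OF near[OF t]] by (intro mult_right_mono) auto
          finally show ?thesis .
        qed
        moreover have "((\<lambda>t. e * norm (v t)) has_integral e * integral {a..b} (\<lambda>t. norm (v t))) {a..b}"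
          using ab' by (intro has_integral_mult_right integrable_integral nint) auto
        ultimately have "norm (integral {a..b} (\<lambda>t. W (c t) \<bullet> v t) - W0 \<bullet> integral {a..b} v) \<le>
            e * integral {a..b} (\<lambda>t. norm (v t))"
          using Henstock_Kurzweil_Integration.integral_norm_bound_integral[of "\<lambda>t. W (c t) \<bullet> v t - W0 \<bullet> v t" "{a..b}"
              "\<lambda>t. e * norm (v t)"] by (simp only: has_integral_iff)
        then have 2: "\<bar>integral {a..b} (\<lambda>t. W (c t) \<bullet> v t) - W0 \<bullet> (c b - c a)\<bar> \<le>
            e * integral {a..b} (\<lambda>t. norm (v t))"
          using cv[of a b] ab' by simp
        from 1 2 show "\<bar>u (c b) - u (c a) - integral {a..b} (\<lambda>t. W (c t) \<bullet> v t)\<bar> \<le>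
            2 * e * integral {a..b} (\<lambda>t. norm (v t))" by linarith
      qed
      then show "\<exists>d>0. \<forall>a b. a \<le> x \<and> x \<le> b \<and> b - a < d \<longrightarrow> P a b" using d(1) by blast
    qed
    then show ?thesis unfolding P_def K_def by simp
  qed
  have K: "K \<ge> 0" unfolding K_def using nint[of 0 1] by (intro Henstock_Kurzweil_Integration.integral_nonneg) auto
  have "\<bar>u (c 1) - u (c 0) - integral {0..1} (\<lambda>t. W (c t) \<bullet> v t)\<bar> \<le> 0 + e" if "e > 0" for e
  proof -
    \<comment> \<open>\<open>K + 1\<close> instead of \<open>K\<close>, since the total length
      \<open>K\<close> is 0 for a constant curve.\<close>
    have "2 * (e / (2 * (K + 1))) * K \<le> e" using that K by (simp add: field_simps)
    then show ?thesis using bound[of "e / (2 * (K + 1))"] that K by simp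
  qed
  then have "\<bar>u (c 1) - u (c 0) - integral {0..1} (\<lambda>t. W (c t) \<bullet> v t)\<bar> \<le> 0"
    by (rule field_le_epsilon)
  then show "u (c 1) - u (c 0) = (LINT t|lebesgue_on {0..1}. W (c t) \<bullet> v t)"
    by (simp add: lebesgue_integral_eq_integral[OF int])
qed

section \<open>Frames with constant curvature\<close>

lemma linear_eq_on_frame:
  fixes L L' :: "(real ^ 'n::finite) \<times> real \<Rightarrow> real"
  assumes "linear L" "linear L'" "\<And>i. L (axis i 1, 0) = L' (axis i 1, 0)" "L (0, 1) = L' (0, 1)"
  shows "L v = L' v"
proof -
  have "(\<Sum>i\<in>UNIV. (fst v $ i *\<^sub>R axis i 1, 0)) = (fst v, 0 :: real)"
    using basis_expansion[of "fst v"]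
    by (simp add: prod_eq_iff fst_sum snd_sum scalar_mult_eq_scaleR)
  then have v: "v = (\<Sum>i\<in>UNIV. fst v $ i *\<^sub>R (axis i 1, 0)) + snd v *\<^sub>R (0, 1)"
    by (simp add: prod_eq_iff)
  show ?thesis
    by (subst (1 2) v) (simp only: linear_add[OF assms(1)] linear_add[OF assms(2)] linear_sum[OF assms(1)]
        linear_sum[OF assms(2)] linear_cmul[OF assms(1)] linear_cmul[OF assms(2)] assms(3,4))
qed

lemma smooth_on_diff:
  fixes f g :: "'v::real_normed_vector \<Rightarrow> real"
  assumes "open S" "smooth_on S f" "smooth_on S g"
  shows "smooth_on S (\<lambda>y. f y - g y)"
  using smooth_on_add[OF assms(1,2) smooth_on_bounded_linear[OF assms(1) bounded_linear_minus[OF bounded_linear_ident] assms(3)]]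
  by simp

lemma frechet_derivative_smooth_cong:
  assumes "open S" "smooth_on S g" "\<And>y. y \<in> S \<Longrightarrow> f y = g y" "y \<in> S"
  shows "frechet_derivative f (at y) = frechet_derivative g (at y)"
proof -
  have "g differentiable (at y)"
    using smooth_on_has_derivative[OF assms(2,4)] unfolding differentiable_def by blast
  from frechet_derivative_transform_within_open[OF this assms(1,4), of f] assms(3) show ?thesis by simp
qed

lemma frechet_derivative_smooth_diff:
  fixes f g :: "'v::real_normed_vector \<Rightarrow> real"
  assumes "smooth_on S f" "smooth_on S g" "y \<in> S"
  shows "frechet_derivative (\<lambda>y. f y - g y) (at y) v = frechet_derivative f (at y) v - frechet_derivative g (at y) v"
  by (rule frechet_derivative_eqI) (intro has_derivative_diff smooth_on_has_derivative[OF _ assms(3)] assms)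

lemma frechet_derivative_smooth_add:
  fixes f g :: "'v::real_normed_vector \<Rightarrow> real"
  assumes "smooth_on S f" "smooth_on S g" "y \<in> S"
  shows "frechet_derivative (\<lambda>y. f y + g y) (at y) v = frechet_derivative f (at y) v + frechet_derivative g (at y) v"
  by (rule frechet_derivative_eqI) (intro has_derivative_add smooth_on_has_derivative[OF _ assms(3)] assms)

lemma frechet_derivative_smooth_mult:
  fixes f g :: "'v::real_normed_vector \<Rightarrow> real"
  assumes "smooth_on S f" "smooth_on S g" "y \<in> S"
  shows "frechet_derivative (\<lambda>y. f y * g y) (at y) v =
    f y * frechet_derivative g (at y) v + frechet_derivative f (at y) v * g y"
  by (rule frechet_derivative_eqI) (intro has_derivative_mult smooth_on_has_derivative[OF _ assms(3)] assms)

text \<open>The situation in the chart, with \<open>B i\<close> the coordinate expression of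
  \<open>A i\<close>. Independence of the last variable enters infinitesimally as
  \<open>B_vertical\<close>, and \<open>B_curl\<close> says that the curvature of the distribution
  is constant.\<close>

locale constant_curvature_frame =
  fixes S :: "((real ^ 'n::finite) \<times> real) set"
    and B :: "'n \<Rightarrow> (real ^ 'n) \<times> real \<Rightarrow> real"
    and c :: "'n \<Rightarrow> 'n \<Rightarrow> real"
  assumes S: "open S"
    and B: "\<And>i. smooth_on S (B i)"
    and B_vertical: "\<And>i y. y \<in> S \<Longrightarrow> frechet_derivative (B i) (at y) (0, 1) = 0"
    and B_curl: "\<And>i j y. y \<in> S \<Longrightarrow>
      frechet_derivative (B j) (at y) (axis i 1, 0) - frechet_derivative (B i) (at y) (axis j 1, 0) = c i j"
begin

definition XD :: "'n \<Rightarrow> ((real ^ 'n) \<times> real \<Rightarrow> real) \<Rightarrow> (real ^ 'n) \<times> real \<Rightarrow> real" where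
  "XD i f y = frechet_derivative f (at y) (axis i 1, B i y)"

abbreviation PD :: "(real ^ 'n) \<times> real \<Rightarrow> ((real ^ 'n) \<times> real \<Rightarrow> real) \<Rightarrow> (real ^ 'n) \<times> real \<Rightarrow> real" where
  "PD v f \<equiv> \<lambda>y. frechet_derivative f (at y) v"

lemma XD_eq:
  assumes "smooth_on S f" "y \<in> S"
  shows "XD i f y = PD (axis i 1, 0) f y + B i y * PD (0, 1) f y"
proof -
  have lin: "linear (frechet_derivative f (at y))"
    using has_derivative_linear[OF smooth_on_has_derivative[OF assms]] .
  have "(axis i 1, B i y) = (axis i 1, 0) + B i y *\<^sub>R (0 :: real ^ 'n, 1 :: real)" by simp
  then show ?thesis
    unfolding XD_def by (simp only: linear_add[OF lin] linear_cmul[OF lin] real_scaleR_def)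
qed

lemma smooth_on_XD:
  assumes "smooth_on S f"
  shows "smooth_on S (XD i f)"
  by (rule smooth_on_cong[OF S XD_eq[OF assms, symmetric]])
     (auto intro!: smooth_on_add smooth_on_mult S B smooth_on_frechet_derivative assms)

lemma XD_cong:
  assumes "smooth_on S g" "\<And>y. y \<in> S \<Longrightarrow> f y = g y" "y \<in> S"
  shows "XD i f y = XD i g y"
  unfolding XD_def using frechet_derivative_smooth_cong[OF S assms(1), of f y] assms(2,3) by simp

lemma PD_XD:
  assumes f: "smooth_on S f" and y: "y \<in> S"
  shows "PD v (XD j f) y =
    PD v (PD (axis j 1, 0) f) y + B j y * PD v (PD (0, 1) f) y + PD v (B j) y * PD (0, 1) f y"
proof -
  note sm = smooth_on_frechet_derivative[OF f]
  have "PD v (XD j f) y = PD v (\<lambda>y. PD (axis j 1, 0) f y + B j y * PD (0, 1) f y) y"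
    using frechet_derivative_smooth_cong[OF S smooth_on_add[OF S sm smooth_on_mult[OF S B sm]] XD_eq[OF f] y]
    by simp
  then show ?thesis
    by (simp add: frechet_derivative_smooth_add[OF sm smooth_on_mult[OF S B sm] y]
        frechet_derivative_smooth_mult[OF B sm y])
qed

text \<open>\<open>B_vertical\<close> removes the term containing the vertical derivative of
  \<open>B j\<close>. The second-order terms are symmetric in \<open>i\<close> and \<open>j\<close>
  up to exchanging mixed derivatives, so only the last term survives in the commutator.\<close>

lemma XD_XD:
  assumes f: "smooth_on S f" and y: "y \<in> S"
  shows "XD i (XD j f) y =
    PD (axis i 1, 0) (PD (axis j 1, 0) f) y + B j y * PD (axis i 1, 0) (PD (0, 1) f) y +
    B i y * PD (0, 1) (PD (axis j 1, 0) f) y + B i y * B j y * PD (0, 1) (PD (0, 1) f) y +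
    PD (axis i 1, 0) (B j) y * PD (0, 1) f y"
  unfolding XD_eq[OF smooth_on_XD[OF f] y] PD_XD[OF f y] B_vertical[OF y] by (simp add: algebra_simps)

lemma XD_commutator:
  assumes f: "smooth_on S f" and y: "y \<in> S"
  shows "XD i (XD j f) y - XD j (XD i f) y = c i j * PD (0, 1) f y"
  unfolding XD_XD[OF f y] B_curl[OF y, symmetric]
    smooth_on_mixed_derivatives[OF S f y, of "(axis j 1, 0)" "(axis i 1, 0)"]
    smooth_on_mixed_derivatives[OF S f y, of "(0, 1)" "(axis _ 1, 0)"]
  by (simp add: algebra_simps)

text \<open>The coefficients of \<open>X i\<close> are constant in the vertical direction, and
  partial derivatives commute.\<close>

lemma XD_PD_vertical:
  assumes f: "smooth_on S f" and y: "y \<in> S"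
  shows "XD i (PD (0, 1) f) y = PD (0, 1) (XD i f) y"
  unfolding XD_eq[OF smooth_on_frechet_derivative[OF f] y] PD_XD[OF f y] B_vertical[OF y]
    smooth_on_mixed_derivatives[OF S f y, of "(0, 1)" "(axis _ 1, 0)"] by simp

lemma XD_smooth_diff:
  assumes "smooth_on S f" "smooth_on S g" "y \<in> S"
  shows "XD i (\<lambda>y. f y - g y) y = XD i f y - XD i g y"
  unfolding XD_def by (rule frechet_derivative_smooth_diff[OF assms])

lemma XD_smooth_cmult:
  assumes "smooth_on S f" "y \<in> S"
  shows "XD i (\<lambda>y. r * f y) y = r * XD i f y"
  unfolding XD_def using frechet_derivative_smooth_mult[OF smooth_on_const assms, of r] by simp

text \<open>Every curl equals \<open>c i j\<close> times the single function
  \<open>PD (0, 1) u\<close>, whence the proportionality. Applying \<open>X k\<close> and moving it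
  past the vertical derivative produces \<open>c i j * PD (0, 1) (f k)\<close>, which is the
  commutator applied to \<open>f k\<close>.\<close>

lemma XD_system_necessary:
  assumes u: "smooth_on S u" and f: "\<And>i y. y \<in> S \<Longrightarrow> f i y = XD i u y" and y: "y \<in> S"
  shows "c k l * (XD i (f j) y - XD j (f i) y) = c i j * (XD k (f l) y - XD l (f k) y)"
    and "XD k (XD i (f j)) y - XD k (XD j (f i)) y = XD i (XD j (f k)) y - XD j (XD i (f k)) y"
proof -
  have fs: "smooth_on S (f i)" for i
    using smooth_on_cong[OF S f[symmetric] smooth_on_XD[OF u]] .
  have Xf: "XD i (f j) y = XD i (XD j u) y" if "y \<in> S" for i j y
    by (rule XD_cong[OF smooth_on_XD[OF u] f that])
  have curl: "XD i (f j) y - XD j (f i) y = c i j * PD (0, 1) u y" if "y \<in> S" for i j y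
    using XD_commutator[OF u that] Xf[OF that] by simp
  show "c k l * (XD i (f j) y - XD j (f i) y) = c i j * (XD k (f l) y - XD l (f k) y)"
    unfolding curl[OF y] by simp
  have "XD k (XD i (f j)) y - XD k (XD j (f i)) y = XD k (\<lambda>y. XD i (f j) y - XD j (f i) y) y"
    by (rule XD_smooth_diff[symmetric]) (intro smooth_on_XD fs y)+
  also have "\<dots> = XD k (\<lambda>y. c i j * PD (0, 1) u y) y"
    by (rule XD_cong[OF _ curl y]) (intro smooth_on_mult S smooth_on_const smooth_on_frechet_derivative u)
  also have "\<dots> = c i j * PD (0, 1) (XD k u) y"
    using XD_smooth_cmult[OF smooth_on_frechet_derivative[OF u] y] XD_PD_vertical[OF u y] by simp
  also have "PD (0, 1) (XD k u) y = PD (0, 1) (f k) y"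
    using frechet_derivative_smooth_cong[OF S smooth_on_XD[OF u] f y] by simp
  also have "c i j * PD (0, 1) (f k) y = XD i (XD j (f k)) y - XD j (XD i (f k)) y"
    by (rule XD_commutator[OF fs y, symmetric])
  finally show "XD k (XD i (f j)) y - XD k (XD j (f i)) y = XD i (XD j (f k)) y - XD j (XD i (f k)) y" .
qed

lemma XD_system_sufficient:
  assumes simply: "simply_connected S" and fs: "\<And>i. smooth_on S (f i)"
    and kl: "c k l \<noteq> 0"
    and curl: "\<And>i j y. y \<in> S \<Longrightarrow>
      c k l * (XD i (f j) y - XD j (f i) y) = c i j * (XD k (f l) y - XD l (f k) y)"
    and second: "\<And>m y. y \<in> S \<Longrightarrow>
      XD m (XD k (f l)) y - XD m (XD l (f k)) y = XD k (XD l (f m)) y - XD l (XD k (f m)) y"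
  obtains u where "smooth_on S u" "\<And>i y. y \<in> S \<Longrightarrow> XD i u y = f i y"
proof -
  define h where "h = (\<lambda>y. (1 / c k l) * (XD k (f l) y - XD l (f k) y))"
  have hs: "smooth_on S h"
    unfolding h_def by (intro smooth_on_mult smooth_on_diff S smooth_on_const smooth_on_XD fs)
  have Xf: "XD i (f j) y - XD j (f i) y = c i j * h y" if "y \<in> S" for i j y
    using curl[OF that, of i j] kl unfolding h_def by (simp add: field_simps)
  \<comment> \<open>By \<open>XD_commutator\<close> the right-hand side of \<open>second\<close> is
    \<open>c k l\<close> times the vertical derivative of \<open>f i\<close>, and
    \<open>c k l\<close> cancels against the normalisation of \<open>h\<close>.\<close>
  have Xh: "XD i h y = PD (0, 1) (f i) y" if y: "y \<in> S" for i y
  proof -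
    have "XD i h y = (1 / c k l) * (XD i (XD k (f l)) y - XD i (XD l (f k)) y)"
      unfolding h_def
      by (simp only: XD_smooth_cmult[OF smooth_on_diff[OF S smooth_on_XD[OF fs] smooth_on_XD[OF fs]] y]
          XD_smooth_diff[OF smooth_on_XD[OF fs] smooth_on_XD[OF fs] y])
    also have "\<dots> = (1 / c k l) * (c k l * PD (0, 1) (f i) y)"
      unfolding second[OF y] XD_commutator[OF fs y] ..
    finally show ?thesis using kl by simp
  qed
  \<comment> \<open>The coordinate vector \<open>(axis i 1, 0)\<close> equals \<open>X i\<close>
    minus \<open>B i\<close> times the vertical one, so a form with values \<open>f i\<close> on
    \<open>X i\<close> and \<open>h\<close> on the vertical field has the value
    \<open>f i - B i * h\<close> on it. \<open>W\<close> is the vector representing this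
    form.\<close>
  define w where "w = (\<lambda>i y. f i y - B i y * h y)"
  define W where "W = (\<lambda>y. (\<Sum>i\<in>UNIV. w i y *\<^sub>R (axis i 1 :: real ^ 'n, 0 :: real)) + h y *\<^sub>R (0, 1))"
  have ws: "smooth_on S (w i)" for i
    unfolding w_def by (intro smooth_on_diff smooth_on_mult S fs B hs)
  have Ws: "smooth_on S W"
    unfolding W_def
    by (intro smooth_on_add smooth_on_sum S smooth_on_bounded_linear[OF S bounded_linear_scaleR_left] ws hs)
  have W_vertical: "W y \<bullet> (0, 1) = h y" for y
    unfolding W_def by (simp add: inner_add_left inner_sum_left)
  have W_horizontal: "W y \<bullet> (axis j 1, 0) = w j y" for y j
  proof -
    have "(w i y *\<^sub>R (axis i 1 :: real ^ 'n, 0 :: real)) \<bullet> (axis j 1, 0) = (if i = j then w i y else 0)" for i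
      by (simp add: inner_axis_axis)
    then show ?thesis unfolding W_def inner_add_left inner_sum_left by simp
  qed
  define W' where "W' = (\<lambda>y. frechet_derivative W (at y))"
  have W': "(W has_derivative W' y) (at y)" if "y \<in> S" for y
    unfolding W'_def using smooth_on_has_derivative[OF Ws that] .
  have W'_inner: "W' y v \<bullet> e = PD v (\<lambda>y. W y \<bullet> e) y" if "y \<in> S" for y v e
    by (rule frechet_derivative_eqI[OF has_derivative_inner_left[OF W'[OF that]], symmetric])
  have W'_vertical: "W' y v \<bullet> (0, 1) = PD v h y" if "y \<in> S" for y v
    unfolding W'_inner[OF that] W_vertical ..
  have W'_horizontal: "W' y v \<bullet> (axis j 1, 0) =
      PD v (f j) y - (B j y * PD v h y + PD v (B j) y * h y)" if y: "y \<in> S" for y v j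
    unfolding W'_inner[OF y] W_horizontal w_def
    by (simp only: frechet_derivative_smooth_diff[OF fs smooth_on_mult[OF S B hs] y]
        frechet_derivative_smooth_mult[OF B hs y])
  \<comment> \<open>Closedness is checked on pairs of constant basis vectors: the pairs with the
    vertical vector express \<open>Xh\<close>, the horizontal pairs express
    \<open>Xf\<close>.\<close>
  have sym: "W' y v \<bullet> v' = W' y v' \<bullet> v" if y: "y \<in> S" for y v v'
  proof -
    have lin: "linear (\<lambda>v. W' y v \<bullet> e)" "linear (\<lambda>v. W' y e \<bullet> v)" for e
      using bounded_linear.linear[OF bounded_linear_inner_right]
        linear_compose[OF has_derivative_linear[OF W'[OF y]] bounded_linear.linear[OF bounded_linear_inner_left]]
      by (auto simp: o_def)
    have vh: "PD (0, 1) (f i) y = PD (axis i 1, 0) h y + B i y * PD (0, 1) h y" for i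
      using Xh[OF y] XD_eq[OF hs y] by simp
    have 1: "W' y (axis i 1, 0) \<bullet> (0, 1) = W' y (0, 1) \<bullet> (axis i 1, 0)" for i
      unfolding W'_vertical[OF y] W'_horizontal[OF y] vh B_vertical[OF y] by simp
    have 2: "W' y (axis i 1, 0) \<bullet> (axis j 1, 0) = W' y (axis j 1, 0) \<bullet> (axis i 1, 0)" for i j
    proof -
      \<comment> \<open>After the vertical derivatives of \<open>f i\<close> and \<open>f j\<close>
        are rewritten by \<open>vh\<close>, the two terms \<open>B i * B j * PD (0, 1) h\<close>
        cancel.\<close>
      have "PD (axis i 1, 0) (f j) y - PD (axis j 1, 0) (f i) y =
          c i j * h y - B i y * PD (axis j 1, 0) h y + B j y * PD (axis i 1, 0) h y"
        using Xf[OF y, of i j] unfolding XD_eq[OF fs y] vh by (simp add: algebra_simps)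
      then show ?thesis
        unfolding W'_horizontal[OF y] B_curl[OF y, of j i, symmetric] by (simp add: algebra_simps)
    qed
    \<comment> \<open>Linearity is used twice: here one argument is arbitrary and the other a basis
      vector, afterwards both are arbitrary.\<close>
    have frame: "W' y v \<bullet> e = W' y e \<bullet> v" if e: "e = (0, 1) \<or> (\<exists>j. e = (axis j 1, 0))" for e v
      by (rule linear_eq_on_frame[OF lin]) (use e 1 2 in auto)
    show ?thesis
      by (rule linear_eq_on_frame[OF lin(2,1)]) (rule frame[symmetric, where v = v] frame[where v = v], blast)+
  qed
  obtain u where u: "\<And>y. y \<in> S \<Longrightarrow> (u has_derivative (\<lambda>v. W y \<bullet> v)) (at y)"
    using simply_connected_closed_form_exact[OF S simply W' _ sym]
      smooth_on_imp_continuous_on[OF smooth_on_frechet_derivative[OF Ws]] unfolding W'_def by metis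
  show ?thesis
  proof (rule that)
    show "smooth_on S u"
      by (rule smooth_onI[OF u S]) (auto intro: smooth_on_bounded_linear[OF S bounded_linear_inner_left] Ws)
    fix i y assume y: "y \<in> S"
    have "W y \<bullet> (axis i 1, B i y) = W y \<bullet> (axis i 1, 0) + B i y * (W y \<bullet> (0, 1))"
      by (simp add: inner_prod_def algebra_simps)
    then show "XD i u y = f i y"
      unfolding XD_def frechet_derivative_eqI[OF u[OF y]] W_horizontal W_vertical w_def by simp
  qed
qed

end

section \<open>Gradients with respect to a metric on the distribution\<close>

text \<open>Completeness of Lebesgue measure transfers measurability to \<open>g\<close>. This is
  needed because a velocity is horizontal only almost everywhere, while the metric takes arbitrary
  values off the distribution.\<close>

lemma integrable_lebesgue_on_AE_cong:
  fixes f g :: "'a::euclidean_space \<Rightarrow> 'b::euclidean_space"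
  assumes f: "integrable (lebesgue_on S) f" and S: "S \<in> sets lebesgue"
    and eq: "AE t in lebesgue_on S. f t = g t"
  shows "integrable (lebesgue_on S) g"
    and "(LINT t|lebesgue_on S. g t) = (LINT t|lebesgue_on S. f t)"
proof -
  have "integrable lebesgue (\<lambda>t. if t \<in> S then f t else 0)"
    using f by (subst Lebesgue_Measure.integrable_restrict_UNIV[OF S])
  then have "(\<lambda>t. if t \<in> S then f t else 0) \<in> borel_measurable lebesgue"
    by (rule borel_measurable_integrable)
  moreover have "AE t in lebesgue. (if t \<in> S then f t else 0) = (if t \<in> S then g t else 0)"
    using eq S by (subst (asm) AE_restrict_space_iff) (auto elim: eventually_mono)
  ultimately have "(\<lambda>t. if t \<in> S then g t else 0) \<in> borel_measurable lebesgue"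
    by (rule borel_measurable_AE)
  then have g: "g \<in> borel_measurable (lebesgue_on S)"
    using S by (simp add: borel_measurable_if)
  note fm = borel_measurable_integrable[OF f]
  show "integrable (lebesgue_on S) g"
    using integrable_cong_AE[OF fm g eq] f by simp
  show "(LINT t|lebesgue_on S. g t) = (LINT t|lebesgue_on S. f t)"
    using integral_cong_AE[OF fm g eq] by simp
qed

text \<open>\<open>W\<close> is the Euclidean gradient in coordinates, not the horizontal one; it
  puts the differential into the form used for integration along curves.\<close>

lemma smooth_on_gradient:
  fixes u :: "'a::euclidean_space \<Rightarrow> real"
  assumes "open S" "smooth_on S u"
  obtains W where "continuous_on S W" "\<And>y. y \<in> S \<Longrightarrow> (u has_derivative (\<lambda>h. W y \<bullet> h)) (at y)"
proof
  let ?W = "\<lambda>y. \<Sum>b\<in>Basis. frechet_derivative u (at y) b *\<^sub>R b"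
  show "continuous_on S ?W"
    by (intro continuous_intros smooth_on_imp_continuous_on smooth_on_frechet_derivative assms)
  fix y assume "y \<in> S"
  from smooth_on_has_derivative[OF assms(2) this]
  have u: "(u has_derivative frechet_derivative u (at y)) (at y)" .
  have eq: "frechet_derivative u (at y) h = ?W y \<bullet> h" for h
  proof -
    have "frechet_derivative u (at y) h = frechet_derivative u (at y) (\<Sum>b\<in>Basis. (h \<bullet> b) *\<^sub>R b)"
      by (simp add: euclidean_representation)
    also have "\<dots> = (\<Sum>b\<in>Basis. (h \<bullet> b) * frechet_derivative u (at y) b)"
      by (simp add: linear_sum[OF has_derivative_linear[OF u]] linear_cmul[OF has_derivative_linear[OF u]])
    also have "\<dots> = ?W y \<bullet> h"
      unfolding inner_sum_left by (simp add: inner_commute[of h] mult.commute)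
    finally show ?thesis .
  qed
  show "(u has_derivative (\<lambda>h. ?W y \<bullet> h)) (at y)"
    by (rule has_derivative_eq_rhs[OF u]) (rule ext, rule eq)
qed

lemma metric_on_distribution_sum_left:
  assumes g: "metric_on_distribution M x D g" and D: "subspace (D p)" and p: "p \<in> M"
    and V: "\<And>i. i \<in> I \<Longrightarrow> V i \<in> D p" and w: "w \<in> D p"
  shows "g p (\<Sum>i\<in>I. r i *\<^sub>R V i) w = (\<Sum>i\<in>I. r i * g p (V i) w)"
proof -
  have lin: "g p (s *\<^sub>R v + t *\<^sub>R v') w = s * g p v w + t * g p v' w" if "v \<in> D p" "v' \<in> D p" for s t v v'
    using g p w that unfolding metric_on_distribution_def by blast
  have zero: "g p 0 w = 0" using lin[OF subspace_0[OF D] subspace_0[OF D], of 0 0] by simp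
  show ?thesis
    using V
  proof (induction I rule: infinite_finite_induct)
    case (insert i I)
    have "(\<Sum>i\<in>I. r i *\<^sub>R V i) \<in> D p"
      using insert.prems by (intro subspace_sum[OF D] subspace_scale[OF D]) auto
    with insert lin[of "V i" "\<Sum>i\<in>I. r i *\<^sub>R V i" "r i" 1] show ?case by simp
  qed (simp_all add: zero)
qed

text \<open>\<open>g p\<close> is bilinear on \<open>D p\<close> only, so the induction over the
  span carries membership in \<open>D p\<close> along. The lemma identifies pairing with
  \<open>v\<close> with any linear functional, such as the differential of a solution, that agrees
  with it on the frame.\<close>

lemma metric_on_distribution_unique_on_span:
  assumes g: "metric_on_distribution M x D g" and D: "subspace (D p)" "D p = span (range X)"
    and p: "p \<in> M" and v: "v \<in> D p"
    and L: "linear L" "\<And>i. L (X i) = g p v (X i)" and w: "w \<in> D p"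
  shows "g p v w = L w"
proof -
  have sym: "g p v w = g p w v" if "w \<in> D p" for w
    using g p v that unfolding metric_on_distribution_def by blast
  have lin: "g p (s *\<^sub>R w + t *\<^sub>R w') v = s * g p w v + t * g p w' v" if "w \<in> D p" "w' \<in> D p" for s t w w'
    using g p v that unfolding metric_on_distribution_def by blast
  have "w \<in> span (range X)" using w D(2) by simp
  then have "w \<in> D p \<and> g p w v = L w"
  proof (induction rule: span_induct_alt)
    case base
    then show ?case
      using lin[OF subspace_0[OF D(1)] subspace_0[OF D(1)], of 0 0] subspace_0[OF D(1)] linear_0[OF L(1)] by simp
  next
    case (step r y z)
    then obtain i where i: "y = X i" by auto
    have y: "y \<in> D p" unfolding D(2) i by (rule span_base) simp
    show ?case
    proof
      show "r *\<^sub>R y + z \<in> D p"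
        using y step by (intro subspace_add[OF D(1)] subspace_scale[OF D(1)]) auto
      show "g p (r *\<^sub>R y + z) v = L (r *\<^sub>R y + z)"
        using lin[OF y, of z r 1] step L(2)[of i] sym[OF y]
        by (simp add: i linear_add[OF L(1)] linear_cmul[OF L(1)])
    qed
  qed
  then show ?thesis using sym w by simp
qed

theorem theorem1p1:
  fixes M :: "'m::topological_space set"
    and x :: "'m \<Rightarrow> (real ^ 'n::finite) \<times> real"
    and D :: "'m \<Rightarrow> ((real ^ 'n) \<times> real) set"
    and g :: "'m \<Rightarrow> (real ^ 'n) \<times> real \<Rightarrow> (real ^ 'n) \<times> real \<Rightarrow> real"
    and A :: "'n \<Rightarrow> 'm \<Rightarrow> real"
    and X :: "'n \<Rightarrow> 'm \<Rightarrow> (real ^ 'n) \<times> real"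
    and c :: "'n \<Rightarrow> 'n \<Rightarrow> real"
    and a :: "'m \<Rightarrow> (real ^ 'n) \<times> real"
    and acomp :: "'n \<Rightarrow> 'm \<Rightarrow> real"
    and gcomp :: "'n \<Rightarrow> 'n \<Rightarrow> 'm \<Rightarrow> real"
    and atilde :: "'n \<Rightarrow> 'm \<Rightarrow> real"
  assumes "CARD('n) \<ge> 2"
    and "sub_riemannian M x CARD('n) D g"
    and "simply_connected M"
    and "\<And>i. smooth_map M x (A i)"
    and "\<And>i p q. p \<in> M \<Longrightarrow> q \<in> M \<Longrightarrow> fst (x p) = fst (x q) \<Longrightarrow> A i p = A i q"
    and "\<And>i p. X i p = coord_field i p + A i p *\<^sub>R last_coord_field p"
    and "\<And>p. p \<in> M \<Longrightarrow> D p = span (range (\<lambda>i. X i p))"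
    and "\<And>i j p. p \<in> M \<Longrightarrow>
           vf_act M x (coord_field i) (A j) p - vf_act M x (coord_field j) (A i) p = c i j"
    and "{(i, j). c i j \<noteq> 0} \<noteq> {}"
    and "a \<in> horizontal_fields M x D"
    and "\<And>p. p \<in> M \<Longrightarrow> a p = (\<Sum>i\<in>UNIV. acomp i p *\<^sub>R X i p)"
    and "\<And>i j p. p \<in> M \<Longrightarrow> gcomp i j p = g p (X i p) (X j p)"
    and "\<And>j p. p \<in> M \<Longrightarrow> atilde j p = (\<Sum>i\<in>UNIV. gcomp i j p * acomp i p)"
  shows "((\<exists>u. gradient_solution M x D g a u) \<longleftrightarrow>
           (\<forall>p\<in>M. \<forall>i j k l.
              c k l * (vf_act M x (X i) (atilde j) p - vf_act M x (X j) (atilde i) p) =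
              c i j * (vf_act M x (X k) (atilde l) p - vf_act M x (X l) (atilde k) p)) \<and>
           (\<forall>p\<in>M. \<forall>i j k.
              vf_act M x (X k) (vf_act M x (X i) (atilde j)) p -
              vf_act M x (X k) (vf_act M x (X j) (atilde i)) p =
              commutator M x (X i) (X j) (atilde k) p)) \<and>
         (\<forall>u x\<^sub>0 p \<gamma> v. gradient_solution M x D g a u \<longrightarrow> x\<^sub>0 \<in> M \<longrightarrow> p \<in> M \<longrightarrow>
            horizontal_curve M x D \<gamma> v \<longrightarrow> pathstart \<gamma> = x\<^sub>0 \<longrightarrow> pathfinish \<gamma> = p \<longrightarrow>
            integrable (lebesgue_on {0..1}) (\<lambda>t. g (\<gamma> t) (a (\<gamma> t)) (v t)) \<and>
            u p = u x\<^sub>0 + (LINT t|lebesgue_on {0..1}. g (\<gamma> t) (a (\<gamma> t)) (v t)))"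
proof -

  \<comment> \<open>Passage to the coordinate chart\<close>
  define S where "S = x ` M"
  define inv where "inv = inv_into M x"
  define B where "B = (\<lambda>i. A i \<circ> inv)"
  define f where "f = (\<lambda>i. atilde i \<circ> inv)"
  note [simp] = inv_def[symmetric]
  have chart: "open S" "homeomorphism M S x inv"
    using assms(2) unfolding sub_riemannian_def global_chart_def S_def inv_def by auto
  have dist: "smooth_distribution M x CARD('n) D" and metric: "metric_on_distribution M x D g"
    using assms(2) unfolding sub_riemannian_def by auto
  have inv_x: "inv (x p) = p" if "p \<in> M" for p
    using homeomorphism_apply1[OF chart(2) that] .
  have x_inv: "x (inv y) = y" "inv y \<in> M" if "y \<in> S" for y
    using chart(2) that unfolding homeomorphism_def by auto
  have xS: "x p \<in> S" if "p \<in> M" for p using that unfolding S_def by blast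
  have smooth_map_iff: "smooth_map M x h \<longleftrightarrow> smooth_on S (h \<circ> inv)" for h :: "'m \<Rightarrow> 'b::real_normed_vector"
    unfolding smooth_map_def S_def inv_def ..
  have simply: "simply_connected S"
    using homeomorphic_simply_connected[OF _ assms(3)] chart(2) unfolding homeomorphic_def by blast
  have Bs: "smooth_on S (B i)" for i using assms(4)[of i] unfolding smooth_map_iff B_def .
  have Xp: "X i p = (axis i 1, A i p)" for i p
    unfolding assms(6) coord_field_def last_coord_field_def by simp
  have BA: "B i (x p) = A i p" if "p \<in> M" for i p
    unfolding B_def using inv_x[OF that] by simp
  \<comment> \<open>\<open>B i\<close> is constant along the part of the vertical line through
    \<open>y\<close> that lies in \<open>S\<close>. The parameters of that part form an open set
    containing 0, so the derivative there is determined.\<close>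
  have vertical: "frechet_derivative (B i) (at y) (0, 1) = 0" if y: "y \<in> S" for i y
  proof -
    note der = smooth_on_has_derivative[OF Bs y]
    have "((\<lambda>t. B i (y + t *\<^sub>R (0, 1))) has_derivative (\<lambda>t. frechet_derivative (B i) (at y) (t *\<^sub>R (0, 1)))) (at 0)"
      by (rule has_derivative_compose[where f = "\<lambda>t. y + t *\<^sub>R (0, 1)" and g = "B i"])
         (use der in \<open>auto intro!: derivative_eq_intros simp flip: zero_prod_def\<close>)
    moreover have "((\<lambda>t. B i (y + t *\<^sub>R (0, 1))) has_derivative (\<lambda>t. 0)) (at 0)"
    proof (rule has_derivative_transform_within_open[OF has_derivative_const[of "B i y"]])
      show "open ((\<lambda>t::real. y + t *\<^sub>R (0, 1)) -` S)"
        by (intro open_vimage chart(1) continuous_intros)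
      show "0 \<in> (\<lambda>t::real. y + t *\<^sub>R (0, 1)) -` S" using y by (simp flip: zero_prod_def)
      fix t :: real assume "t \<in> (\<lambda>t. y + t *\<^sub>R (0, 1)) -` S"
      then have t: "y + t *\<^sub>R (0, 1) \<in> S" by simp
      show "B i y = B i (y + t *\<^sub>R (0, 1))"
        unfolding B_def o_def
        by (rule assms(5)) (use x_inv[OF y] x_inv[OF t] in auto)
    qed
    ultimately have "(\<lambda>t. frechet_derivative (B i) (at y) (t *\<^sub>R (0, 1))) = (\<lambda>t. 0)"
      by (rule has_derivative_unique)
    from fun_cong[OF this, of 1] show ?thesis by simp
  qed
  have curl: "frechet_derivative (B j) (at y) (axis i 1, 0) - frechet_derivative (B i) (at y) (axis j 1, 0) = c i j"
    if "y \<in> S" for i j y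
    using assms(8)[OF x_inv(2)[OF that], of i j] x_inv(1)[OF that]
    unfolding vf_act_def coord_field_def B_def by simp
  interpret constant_curvature_frame S B c
    by unfold_locales (use chart(1) Bs vertical curl in auto)
  have act: "vf_act M x (X i) h p = XD i (h \<circ> inv) (x p)" if "p \<in> M" for i p and h :: "'m \<Rightarrow> real"
    unfolding vf_act_def XD_def Xp using BA[OF that] by simp
  have act2: "vf_act M x (X k) (vf_act M x (X i) h) p = XD k (XD i (h \<circ> inv)) (x p)"
    if p: "p \<in> M" and h: "smooth_on S (h \<circ> inv)" for i k p and h :: "'m \<Rightarrow> real"
  proof -
    \<comment> \<open>The inner derivatives agree on \<open>S\<close> only, which is enough for the
      outer derivative because \<open>S\<close> is open.\<close>
    have "(vf_act M x (X i) h \<circ> inv) y = XD i (h \<circ> inv) y" if "y \<in> S" for y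
      using act[OF x_inv(2)[OF that]] x_inv(1)[OF that] by simp
    then show ?thesis
      unfolding act[OF p] by (rule XD_cong[OF smooth_on_XD[OF h] _ xS[OF p]])
  qed

  \<comment> \<open>The metric, the field \<open>a\<close> and the reduction to scalar
    equations\<close>
  have a: "smooth_map M x a" "\<And>p. p \<in> M \<Longrightarrow> a p \<in> D p"
    using assms(10) unfolding horizontal_fields_def by auto
  have subsp: "subspace (D p)" if "p \<in> M" for p
    using dist that unfolding smooth_distribution_def by blast
  have XDp: "X i p \<in> D p" if "p \<in> M" for i p
    unfolding assms(7)[OF that] by (rule span_base) simp
  have Xhor: "X i \<in> horizontal_fields M x D" for i
  proof -
    have "smooth_on S (\<lambda>y. (axis i (1::real), 0::real) + B i y *\<^sub>R (0, 1))"
      by (intro smooth_on_add chart(1) smooth_on_const smooth_on_bounded_linear[OF chart(1) bounded_linear_scaleR_left] Bs)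
    then have "smooth_on S (X i \<circ> inv)"
      by (simp add: o_def Xp B_def)
    then show ?thesis unfolding horizontal_fields_def smooth_map_iff using XDp by auto
  qed
  have atilde: "atilde j p = g p (a p) (X j p)" if p: "p \<in> M" for j p
  proof -
    have "g p (a p) (X j p) = (\<Sum>i\<in>UNIV. acomp i p * g p (X i p) (X j p))"
      unfolding assms(11)[OF p]
      by (rule metric_on_distribution_sum_left[OF metric subsp[OF p] p]) (use XDp[OF p] in auto)
    then show ?thesis
      using assms(13)[OF p] assms(12)[OF p] by (simp add: mult.commute)
  qed
  \<comment> \<open>Smoothness comes from writing \<open>atilde i\<close> as the metric product of
    the two horizontal fields \<open>a\<close> and \<open>X i\<close>.\<close>
  have fs: "smooth_on S (f i)" for i
  proof -
    have "smooth_map M x (\<lambda>p. g p (a p) (X i p))"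
      using metric assms(10) Xhor unfolding metric_on_distribution_def by blast
    then have "smooth_on S ((\<lambda>p. g p (a p) (X i p)) \<circ> inv)" unfolding smooth_map_iff .
    then show ?thesis
      by (rule smooth_on_cong[OF chart(1), rotated]) (use atilde x_inv in \<open>simp add: f_def\<close>)
  qed
  have act_atilde: "vf_act M x (X i) (atilde j) p = XD i (f j) (x p)"
    "vf_act M x (X k) (vf_act M x (X i) (atilde j)) p = XD k (XD i (f j)) (x p)" if "p \<in> M" for i j k p
    using act[OF that, of i "atilde j"] act2[OF that fs[unfolded f_def], of k i j] unfolding f_def by simp_all
  have g_eq: "g p (a p) w = L w"
    if "p \<in> M" "linear L" "\<And>i. L (X i p) = atilde i p" "w \<in> D p" for p L w
    by (rule metric_on_distribution_unique_on_span[OF metric subsp assms(7)])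
       (use that a(2) atilde in auto)
  \<comment> \<open>The gradient identity tests all horizontal fields. At each point both of its
    sides are linear on \<open>D p\<close>, so the frame fields suffice.\<close>
  have solution_iff: "gradient_solution M x D g a u \<longleftrightarrow>
      smooth_on S (u \<circ> inv) \<and> (\<forall>i. \<forall>y\<in>S. XD i (u \<circ> inv) y = f i y)" for u
  proof
    assume u: "gradient_solution M x D g a u"
    have "XD i (u \<circ> inv) y = f i y" if y: "y \<in> S" for i y
    proof -
      have "g (inv y) (a (inv y)) (X i (inv y)) = vf_act M x (X i) u (inv y)"
        using u Xhor x_inv(2)[OF y] unfolding gradient_solution_def is_horizontal_gradient_def by blast
      then show ?thesis
        using act[OF x_inv(2)[OF y], of i u] atilde[OF x_inv(2)[OF y], of i] x_inv(1)[OF y] by (simp add: f_def)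
    qed
    then show "smooth_on S (u \<circ> inv) \<and> (\<forall>i. \<forall>y\<in>S. XD i (u \<circ> inv) y = f i y)"
      using u unfolding gradient_solution_def smooth_map_iff by blast
  next
    assume u: "smooth_on S (u \<circ> inv) \<and> (\<forall>i. \<forall>y\<in>S. XD i (u \<circ> inv) y = f i y)"
    have "g p (a p) (Y p) = vf_act M x Y u p" if Y: "Y \<in> horizontal_fields M x D" and p: "p \<in> M" for Y p
      unfolding vf_act_def
    proof (rule g_eq[OF p])
      show "linear (frechet_derivative (u \<circ> inv_into M x) (at (x p)))"
        using has_derivative_linear[OF smooth_on_has_derivative[OF conjunct1[OF u] xS[OF p]]] by simp
      show "frechet_derivative (u \<circ> inv_into M x) (at (x p)) (X i p) = atilde i p" for i
        using u xS[OF p] act[OF p, of i u] inv_x[OF p] unfolding vf_act_def f_def by simp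
      show "Y p \<in> D p" using Y p unfolding horizontal_fields_def by blast
    qed
    then show "gradient_solution M x D g a u"
      using u assms(10) unfolding gradient_solution_def is_horizontal_gradient_def smooth_map_iff by blast
  qed
  have ex_iff: "(\<exists>u. gradient_solution M x D g a u) \<longleftrightarrow>
      (\<exists>u. smooth_on S u \<and> (\<forall>i. \<forall>y\<in>S. XD i u y = f i y))"
  proof
    assume "\<exists>u. smooth_on S u \<and> (\<forall>i. \<forall>y\<in>S. XD i u y = f i y)"
    then obtain u where u: "smooth_on S u" "\<And>i y. y \<in> S \<Longrightarrow> XD i u y = f i y" by blast
    \<comment> \<open>A solution on the chart is pulled back as \<open>u \<circ> x\<close>. Read in
      the chart again it agrees with \<open>u\<close> on \<open>S\<close>, but possibly not
      elsewhere.\<close>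
    have eq: "(u \<circ> x \<circ> inv) y = u y" if "y \<in> S" for y using x_inv(1)[OF that] by simp
    have "smooth_on S (u \<circ> x \<circ> inv)"
      by (rule smooth_on_cong[OF chart(1) _ u(1)]) (use eq in simp)
    moreover have "XD i (u \<circ> x \<circ> inv) y = f i y" if "y \<in> S" for i y
      by (rule trans[OF XD_cong[OF u(1) eq that] u(2)[OF that]])
    ultimately show "\<exists>u. gradient_solution M x D g a u" unfolding solution_iff by blast
  qed (auto simp: solution_iff)
  have on_chart: "(\<forall>p\<in>M. Q (x p)) \<longleftrightarrow> (\<forall>y\<in>S. Q y)" for Q
    unfolding S_def by blast
  have "(\<exists>u. smooth_on S u \<and> (\<forall>i. \<forall>y\<in>S. XD i u y = f i y)) \<longleftrightarrow>
     (\<forall>y\<in>S. \<forall>i j k l. c k l * (XD i (f j) y - XD j (f i) y) = c i j * (XD k (f l) y - XD l (f k) y)) \<and>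
     (\<forall>y\<in>S. \<forall>i j k. XD k (XD i (f j)) y - XD k (XD j (f i)) y = XD i (XD j (f k)) y - XD j (XD i (f k)) y)"
    (is "?ex \<longleftrightarrow> ?curl \<and> ?second")
  proof
    assume ?ex
    then obtain u where "smooth_on S u" "\<And>i y. y \<in> S \<Longrightarrow> f i y = XD i u y" by metis
    from XD_system_necessary[OF this] show "?curl \<and> ?second" by blast
  next
    assume cond: "?curl \<and> ?second"
    obtain k l where kl: "c k l \<noteq> 0" using assms(9) by blast
    obtain u where "smooth_on S u" "\<And>i y. y \<in> S \<Longrightarrow> XD i u y = f i y"
      by (rule XD_system_sufficient[of f, OF simply fs kl]) (use cond in blast)+
    then show ?ex by blast
  qed
  also have "\<dots> \<longleftrightarrow>
     (\<forall>p\<in>M. \<forall>i j k l.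
        c k l * (vf_act M x (X i) (atilde j) p - vf_act M x (X j) (atilde i) p) =
        c i j * (vf_act M x (X k) (atilde l) p - vf_act M x (X l) (atilde k) p)) \<and>
     (\<forall>p\<in>M. \<forall>i j k.
        vf_act M x (X k) (vf_act M x (X i) (atilde j)) p -
        vf_act M x (X k) (vf_act M x (X j) (atilde i)) p =
        commutator M x (X i) (X j) (atilde k) p)"
    unfolding on_chart[symmetric] commutator_def
    by (simp add: act_atilde)
  finally have iff: "(\<exists>u. gradient_solution M x D g a u) \<longleftrightarrow> \<dots>" unfolding ex_iff .

  \<comment> \<open>The integral formula along horizontal curves\<close>
  have curve: "integrable (lebesgue_on {0..1}) (\<lambda>t. g (\<gamma> t) (a (\<gamma> t)) (v t)) \<and>
      u p = u x\<^sub>0 + (LINT t|lebesgue_on {0..1}. g (\<gamma> t) (a (\<gamma> t)) (v t))"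
    if u: "gradient_solution M x D g a u" and \<gamma>: "horizontal_curve M x D \<gamma> v"
      and ends: "pathstart \<gamma> = x\<^sub>0" "pathfinish \<gamma> = p" for u x\<^sub>0 p \<gamma> v
  proof -
    have us: "smooth_on S (u \<circ> inv)" and Xu: "\<And>i y. y \<in> S \<Longrightarrow> XD i (u \<circ> inv) y = f i y"
      using u unfolding solution_iff by auto
    obtain W where W: "continuous_on S W" "\<And>y. y \<in> S \<Longrightarrow> ((u \<circ> inv) has_derivative (\<lambda>h. W y \<bullet> h)) (at y)"
      using smooth_on_gradient[OF chart(1) us] by blast
    have path: "continuous_on {0..1} \<gamma>" "\<gamma> ` {0..1} \<subseteq> M" and w: "W12_weak_derivative (x \<circ> \<gamma>) v"
      and hor: "AE t in lebesgue_on {0..1}. v t \<in> D (\<gamma> t)"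
      using \<gamma> unfolding horizontal_curve_def path_def path_image_def by auto
    have cont: "continuous_on {0..1} (x \<circ> \<gamma>)"
      using path continuous_on_subset[OF homeomorphism_cont1[OF chart(2)]] by (intro continuous_on_compose) auto
    have image: "(x \<circ> \<gamma>) ` {0..1} \<subseteq> S" using path(2) unfolding S_def by auto
    have v: "integrable (lebesgue_on {0..1}) v"
      using w L2_unit_interval_integrable unfolding W12_weak_derivative_def by blast
    note gradient = integral_gradient_along_curve[OF chart(1) W(2,1) cont image v W12_weak_derivative_integral[OF w cont]]
    \<comment> \<open>The Euclidean gradient \<open>W\<close> and the metric pairing with
      \<open>a\<close> agree on \<open>D\<close>, since both give \<open>atilde i\<close> on
      \<open>X i\<close>. Horizontality of \<open>v t\<close> is what allows the
      replacement.\<close>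
    have eq: "W ((x \<circ> \<gamma>) t) \<bullet> v t = g (\<gamma> t) (a (\<gamma> t)) (v t)" if t: "v t \<in> D (\<gamma> t)" "t \<in> {0..1}" for t
    proof (rule g_eq[symmetric])
      show M: "\<gamma> t \<in> M" using path(2) t(2) by blast
      show "linear ((\<bullet>) (W ((x \<circ> \<gamma>) t)))"
        by (intro bounded_linear.linear bounded_linear_inner_right)
      show "W ((x \<circ> \<gamma>) t) \<bullet> X i (\<gamma> t) = atilde i (\<gamma> t)" for i
        using Xu[OF xS[OF M], of i] frechet_derivative_eqI[OF W(2)[OF xS[OF M]]]
        unfolding XD_def f_def Xp using BA[OF M] inv_x[OF M] by simp
    qed (rule t(1))
    have ae: "AE t in lebesgue_on {0..1}. W ((x \<circ> \<gamma>) t) \<bullet> v t = g (\<gamma> t) (a (\<gamma> t)) (v t)"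
      by (rule lebesgue_on_mono[OF hor eq])
    have "\<gamma> 0 \<in> M" "\<gamma> 1 \<in> M" using path(2) by auto
    then have "(u \<circ> inv) ((x \<circ> \<gamma>) 1) - (u \<circ> inv) ((x \<circ> \<gamma>) 0) = u p - u x\<^sub>0"
      using ends inv_x unfolding pathstart_def pathfinish_def by simp
    then show ?thesis
      using integrable_lebesgue_on_AE_cong[OF gradient(1) _ ae] gradient(2) by simp
  qed
  show ?thesis using iff curve by blast
qed

end
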